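(* Let $\{(z^k,w_1^k,\dots,w_{n-1}^k)\}$, $\{(x_i^k,y_i^k)\}$ ($i=1,\dots,n$), $\{\alpha_k\}$ and $\{\rho_i^k\}$ be the (infinite) sequences generated by Algorithm 2 (described in the context), and let $p^k=(z^k,w_1^k,\dots,w_{n-1}^k)$ for all $k\ge -1$. Assume that $$\sum_{k=0}^\infty \alpha_k\|p^k-p^{k-1}\|_\gamma^2<\infty$$ and that there are constants $\underline{\rho},\overline{\rho}$ such that, for $i=1,\dots,n$, $$0<\underline{\rho}\le\rho_i^k\le\overline{\rho}<\infty\qquad\forall k\ge 0.$$ Then there exists $(z^\infty,w_1^\infty,\dots,w_{n-1}^\infty)\in\mathcal{S}$ such that $z^k\rightharpoonup z^\infty$ and $w_i^k\rightharpoonup w_i^\infty$ for $i=1,\dots,n-1$ (weak convergence). Furthermore, $x_i^k\rightharpoonup G_iz^\infty$ and $y_i^k\rightharpoonup w_i^\infty$ for $i=1,\dots,n$, where $w_n^\infty:=-\sum_{i=1}^{n-1}G_i^*w_i^\infty$.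
   Context: Setting. Let $n\ge 2$, let $\mathcal{H}_0,\mathcal{H}_1,\dots,\mathcal{H}_n$ be real Hilbert spaces with $\mathcal{H}_0=\mathcal{H}_n$ (inner products all denoted $\langle\cdot,\cdot\rangle$, norms $\|\cdot\|$). Let $\boldsymbol{\mathcal{H}}=\mathcal{H}_0\times\mathcal{H}_1\times\dots\times\mathcal{H}_{n-1}$ be endowed, for a given $\gamma>0$, with $\langle(z,w),(z',w')\rangle_\gamma=\gamma\langle z,z'\rangle+\sum_{i=1}^{n-1}\langle w_i,w_i'\rangle$ and norm $\|(z,w)\|_\gamma^2=\gamma\|z\|^2+\sum_{i=1}^{n-1}\|w_i\|^2$. For $i=1,\dots,n$, $T_i:\mathcal{H}_i\rightrightarrows\mathcal{H}_i$ is (set-valued) maximal monotone and $G_i:\mathcal{H}_0\to\mathcal{H}_i$ is bounded linear, with $G_n=I$ the identity. It is assumed that there is at least one $z\in\mathcal{H}_0$ with $0\in\sum_{i=1}^nG_i^*T_iG_i(z)$. The extended solution set is $$\mathcal{S}=\Big\{(z,w_1,\dots,w_{n-1})\in\boldsymbol{\mathcal{H}}\;:\; w_i\in T_i(G_iz),\ i=1,\dots,n-1,\ -\sum_{i=1}^{n-1}G_i^*w_i\in T_n(z)\Big\}.$$ Algorithm 2. (0) Let $(z^{-1},w_1^{-1},\dots,w_{n-1}^{-1})=(z^0,w_1^0,\dots,w_{n-1}^0)\in\boldsymbol{\mathcal{H}}$, $0\le\alpha,\sigma<1$, $0<\underline{\beta}\le\overline{\beta}<2$ and $\gamma>0$ be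 given; set $k=0$. (1) Choose $\alpha_k\in[0,\alpha]$ and let $\widehat z^k=z^k+\alpha_k(z^k-z^{k-1})$, $\widehat w_i^k=w_i^k+\alpha_k(w_i^k-w_i^{k-1})$ for $i=1,\dots,n-1$, and $\widehat w_n^k=-\sum_{i=1}^{n-1}G_i^*\widehat w_i^k$. (2) Choose scalars $\rho_i^k>0$ and compute $(x_i^k,y_i^k)$, with an error $e_i^k\in\mathcal{H}_i$, $i=1,\dots,n$, such that $y_i^k\in T_i(x_i^k)$, $\rho_i^ky_i^k+x_i^k=G_i\widehat z^k+\rho_i^k\widehat w_i^k+e_i^k$ and $\|e_i^k\|^2\le\sigma^2\big(\|G_i\widehat z^k-x_i^k\|^2+\|\rho_i^k(\widehat w_i^k-y_i^k)\|^2\big)$. (3) If $x_i^k=G_ix_n^k$ ($i=1,\dots,n-1$) and $\sum_{i=1}^{n-1}G_i^*y_i^k+y_n^k=0$, stop. Otherwise define $$\varphi_k(\widehat p^k)=\sum_{i=1}^{n-1}\langle G_i\widehat z^k-x_i^k,y_i^k-\widehat w_i^k\rangle+\Big\langle G_n\widehat z^k-x_n^k,\,y_n^k+\sum_{i=1}^{n-1}G_i^*\widehat w_i^k\Big\rangle,$$ $$\theta_k=\frac{\max\{0,\varphi_k(\widehat p^k)\}}{\gamma^{-1}\big\|\sum_{i=1}^{n-1}G_i^*y_i^k+y_n^k\big\|^2+\sum_{i=1}^{n-1}\|x_i^k-G_ix_n^k\|^2}.$$ (4) Choose $\beta_k\in[\underline{\beta},\overline{\beta}]$ and define $z^{k+1}=\widehat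 z^k-\gamma^{-1}\beta_k\theta_k\big(\sum_{i=1}^{n-1}G_i^*y_i^k+y_n^k\big)$ and $w_i^{k+1}=\widehat w_i^k-\beta_k\theta_k(x_i^k-G_ix_n^k)$, $i=1,\dots,n-1$. (5) Let $k\leftarrow k+1$ and go to step (1). Standing assumption: Algorithm 2 never stops at step (3), so it generates infinite sequences. *)

theory Defs
  imports "HOL-Analysis.Analysis" "HOL-Library.Set_Algebras"
begin

text \<open>
  The family of real Hilbert spaces has variable length, so its members cannot be types.
  They are complete linear subspaces, with the induced inner product, of one ambient real
  inner product space. This loses no generality: any finite family of Hilbert spaces embeds
  isometrically in its direct sum. The subspaces may overlap or coincide arbitrarily. All
  operators are relative to these carriers; values outside the carriers are irrelevant.
\<close>

definition hilbert_subspace :: "'a::real_inner set \<Rightarrow> bool" where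
  "hilbert_subspace A \<longleftrightarrow> subspace A \<and> complete A"

definition bounded_linear_on ::
    "'a::real_normed_vector set \<Rightarrow> 'b::real_normed_vector set \<Rightarrow> ('a \<Rightarrow> 'b) \<Rightarrow> bool" where
  "bounded_linear_on A B f \<longleftrightarrow>
     f ` A \<subseteq> B \<and>
     (\<forall>u\<in>A. \<forall>v\<in>A. f (u + v) = f u + f v) \<and>
     (\<forall>c. \<forall>u\<in>A. f (c *\<^sub>R u) = c *\<^sub>R f u) \<and>
     (\<exists>K. \<forall>u\<in>A. norm (f u) \<le> K * norm u)"

text \<open>
  Adjoint of a bounded linear \<open>f\<close> from \<open>A\<close> into a second subspace, as a map back into \<open>A\<close>.
  The vector described exists and is unique by Riesz representation in \<open>A\<close>.
\<close>

definition adjoint_on :: "'a::real_inner set \<Rightarrow> ('a \<Rightarrow> 'a) \<Rightarrow> 'a \<Rightarrow> 'a" where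
  "adjoint_on A f v = (THE u. u \<in> A \<and> (\<forall>z\<in>A. inner (f z) v = inner z u))"

definition weakly_converges_on ::
    "'a::real_inner set \<Rightarrow> (nat \<Rightarrow> 'a) \<Rightarrow> 'a \<Rightarrow> bool" where
  "weakly_converges_on A X l \<longleftrightarrow>
     range X \<subseteq> A \<and> l \<in> A \<and>
     (\<forall>f :: 'a \<Rightarrow> real. bounded_linear_on A UNIV f \<longrightarrow> (\<lambda>k. f (X k)) \<longlonglongrightarrow> f l)"

definition op_graph :: "'a set \<Rightarrow> ('a \<Rightarrow> 'a set) \<Rightarrow> ('a \<times> 'a) set" where
  "op_graph A T = {(x, y). x \<in> A \<and> y \<in> T x}"

definition monotone_op :: "'a::real_inner set \<Rightarrow> ('a \<Rightarrow> 'a set) \<Rightarrow> bool" where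
  "monotone_op A T \<longleftrightarrow>
     op_graph A T \<subseteq> A \<times> A \<and>
     (\<forall>(x, y) \<in> op_graph A T. \<forall>(x', y') \<in> op_graph A T. inner (x - x') (y - y') \<ge> 0)"

definition maximal_monotone_op :: "'a::real_inner set \<Rightarrow> ('a \<Rightarrow> 'a set) \<Rightarrow> bool" where
  "maximal_monotone_op A T \<longleftrightarrow>
     monotone_op A T \<and>
     (\<forall>T'. monotone_op A T' \<and> op_graph A T \<subseteq> op_graph A T' \<longrightarrow> op_graph A T' = op_graph A T)"

text \<open>The operator inclusion uses image and Minkowski sum of sets.\<close>

definition splitting_problem ::
    "nat \<Rightarrow> (nat \<Rightarrow> 'a::real_inner set) \<Rightarrow> (nat \<Rightarrow> 'a \<Rightarrow> 'a set) \<Rightarrow> (nat \<Rightarrow> 'a \<Rightarrow> 'a) \<Rightarrow> bool" where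
  "splitting_problem n H T G \<longleftrightarrow>
     n \<ge> 2 \<and>
     (\<forall>i\<in>{0..n}. hilbert_subspace (H i)) \<and> H 0 = H n \<and>
     (\<forall>i\<in>{1..n}. maximal_monotone_op (H i) (T i)) \<and>
     (\<forall>i\<in>{1..n}. bounded_linear_on (H 0) (H i) (G i)) \<and>
     (\<forall>z\<in>H 0. G n z = z) \<and>
     (\<exists>z\<in>H 0. 0 \<in> (\<Sum>i=1..n. adjoint_on (H 0) (G i) ` T i (G i z)))"

text \<open>
  A point \<open>(z, w)\<close> of the product space stores the tuple of dual components as a function on
  indices, of which only the values at \<open>1, \<dots>, n - 1\<close> carry meaning.
\<close>

definition prod_space :: "nat \<Rightarrow> (nat \<Rightarrow> 'a set) \<Rightarrow> ('a \<times> (nat \<Rightarrow> 'a)) set" where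
  "prod_space n H = H 0 \<times> (\<Pi> i\<in>{1..<n}. H i)"

definition inner_gamma ::
    "nat \<Rightarrow> real \<Rightarrow> 'a::real_inner \<times> (nat \<Rightarrow> 'a) \<Rightarrow> 'a \<times> (nat \<Rightarrow> 'a) \<Rightarrow> real" where
  "inner_gamma n \<gamma> p q =
     \<gamma> * inner (fst p) (fst q) + (\<Sum>i=1..<n. inner (snd p i) (snd q i))"

definition norm_gamma :: "nat \<Rightarrow> real \<Rightarrow> 'a::real_inner \<times> (nat \<Rightarrow> 'a) \<Rightarrow> real" where
  "norm_gamma n \<gamma> p = sqrt (inner_gamma n \<gamma> p p)"

definition dual_sum ::
    "nat \<Rightarrow> (nat \<Rightarrow> 'a::real_inner set) \<Rightarrow> (nat \<Rightarrow> 'a \<Rightarrow> 'a) \<Rightarrow> (nat \<Rightarrow> 'a) \<Rightarrow> 'a" where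
  "dual_sum n H G w = (\<Sum>i=1..<n. adjoint_on (H 0) (G i) (w i))"

text \<open>The convention \<open>w\<^sub>n = - (G\<^sub>1\<^sup>* w\<^sub>1 + \<dots> + G\<^sub>n\<^sub>-\<^sub>1\<^sup>* w\<^sub>n\<^sub>-\<^sub>1)\<close>.\<close>

definition with_last ::
    "nat \<Rightarrow> (nat \<Rightarrow> 'a::real_inner set) \<Rightarrow> (nat \<Rightarrow> 'a \<Rightarrow> 'a) \<Rightarrow> (nat \<Rightarrow> 'a) \<Rightarrow> nat \<Rightarrow> 'a" where
  "with_last n H G w i = (if i = n then - dual_sum n H G w else w i)"

definition extended_solution_set ::
    "nat \<Rightarrow> (nat \<Rightarrow> 'a::real_inner set) \<Rightarrow> (nat \<Rightarrow> 'a \<Rightarrow> 'a set) \<Rightarrow> (nat \<Rightarrow> 'a \<Rightarrow> 'a) \<Rightarrow>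
     ('a \<times> (nat \<Rightarrow> 'a)) set" where
  "extended_solution_set n H T G =
     {(z, w) \<in> prod_space n H.
        (\<forall>i\<in>{1..<n}. w i \<in> T i (G i z)) \<and> - dual_sum n H G w \<in> T n z}"

definition separator ::
    "nat \<Rightarrow> (nat \<Rightarrow> 'a::real_inner set) \<Rightarrow> (nat \<Rightarrow> 'a \<Rightarrow> 'a) \<Rightarrow>
     (nat \<Rightarrow> 'a) \<Rightarrow> (nat \<Rightarrow> 'a) \<Rightarrow> 'a \<times> (nat \<Rightarrow> 'a) \<Rightarrow> real" where
  "separator n H G x y p =
     (\<Sum>i=1..<n. inner (G i (fst p) - x i) (y i - snd p i)) +
     inner (G n (fst p) - x n) (y n + dual_sum n H G (snd p))"

definition step_theta ::
    "nat \<Rightarrow> (nat \<Rightarrow> 'a::real_inner set) \<Rightarrow> (nat \<Rightarrow> 'a \<Rightarrow> 'a) \<Rightarrow> real \<Rightarrow>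
     (nat \<Rightarrow> 'a) \<Rightarrow> (nat \<Rightarrow> 'a) \<Rightarrow> 'a \<times> (nat \<Rightarrow> 'a) \<Rightarrow> real" where
  "step_theta n H G \<gamma> x y p =
     max 0 (separator n H G x y p) /
     (inverse \<gamma> * (norm (dual_sum n H G y + y n))\<^sup>2 +
      (\<Sum>i=1..<n. (norm (x i - G i (x n)))\<^sup>2))"

text \<open>
  The iterates \<open>z\<close> and \<open>w\<close> are indexed by integers, of which only those \<open>\<ge> -1\<close> matter; all
  other sequences start at \<open>0\<close>. The iteration is the first argument and the block index the
  second, so \<open>w k i\<close> is the i-th dual component of iterate \<open>k\<close>.
\<close>

definition extrapolate :: "(nat \<Rightarrow> real) \<Rightarrow> (int \<Rightarrow> 'a::real_vector) \<Rightarrow> nat \<Rightarrow> 'a" where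
  "extrapolate \<alpha> s k = s (int k) + \<alpha> k *\<^sub>R (s (int k) - s (int k - 1))"

definition what ::
    "nat \<Rightarrow> (nat \<Rightarrow> 'a::real_inner set) \<Rightarrow> (nat \<Rightarrow> 'a \<Rightarrow> 'a) \<Rightarrow>
     (nat \<Rightarrow> real) \<Rightarrow> (int \<Rightarrow> nat \<Rightarrow> 'a) \<Rightarrow> nat \<Rightarrow> nat \<Rightarrow> 'a" where
  "what n H G \<alpha> w k = with_last n H G (\<lambda>i. extrapolate \<alpha> (\<lambda>j. w j i) k)"

text \<open>
  All sequences are infinite runs of the algorithm: the stopping test is required to fail at
  every iteration. The parameters \<open>\<alpha>'\<close>, \<open>\<beta>_lo\<close>, \<open>\<beta>_hi\<close> are the bounds for the sequences
  \<open>\<alpha>\<close> and \<open>\<beta>\<close>.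
\<close>

definition inertial_splitting_run ::
    "nat \<Rightarrow> (nat \<Rightarrow> 'a::real_inner set) \<Rightarrow> (nat \<Rightarrow> 'a \<Rightarrow> 'a set) \<Rightarrow> (nat \<Rightarrow> 'a \<Rightarrow> 'a) \<Rightarrow>
     real \<Rightarrow> real \<Rightarrow> real \<Rightarrow> real \<Rightarrow> real \<Rightarrow>
     (int \<Rightarrow> 'a) \<Rightarrow> (int \<Rightarrow> nat \<Rightarrow> 'a) \<Rightarrow>
     (nat \<Rightarrow> nat \<Rightarrow> 'a) \<Rightarrow> (nat \<Rightarrow> nat \<Rightarrow> 'a) \<Rightarrow> (nat \<Rightarrow> nat \<Rightarrow> 'a) \<Rightarrow>
     (nat \<Rightarrow> real) \<Rightarrow> (nat \<Rightarrow> nat \<Rightarrow> real) \<Rightarrow> (nat \<Rightarrow> real) \<Rightarrow> bool" where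
  "inertial_splitting_run n H T G \<gamma> \<alpha>' \<sigma> \<beta>_lo \<beta>_hi z w x y e \<alpha> \<rho> \<beta> \<longleftrightarrow>
     0 \<le> \<alpha>' \<and> \<alpha>' < 1 \<and> 0 \<le> \<sigma> \<and> \<sigma> < 1 \<and> 0 < \<beta>_lo \<and> \<beta>_lo \<le> \<beta>_hi \<and> \<beta>_hi < 2 \<and> 0 < \<gamma> \<and>
     (z 0, w 0) \<in> prod_space n H \<and> z (- 1) = z 0 \<and> (\<forall>i\<in>{1..<n}. w (- 1) i = w 0 i) \<and>
     (\<forall>k.
        0 \<le> \<alpha> k \<and> \<alpha> k \<le> \<alpha>' \<and>
        (\<forall>i\<in>{1..n}.
           \<rho> k i > 0 \<and>
           x k i \<in> H i \<and> e k i \<in> H i \<and> y k i \<in> T i (x k i) \<and>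
           \<rho> k i *\<^sub>R y k i + x k i =
             G i (extrapolate \<alpha> z k) + \<rho> k i *\<^sub>R what n H G \<alpha> w k i + e k i \<and>
           (norm (e k i))\<^sup>2 \<le>
             \<sigma>\<^sup>2 * ((norm (G i (extrapolate \<alpha> z k) - x k i))\<^sup>2 +
                   (norm (\<rho> k i *\<^sub>R (what n H G \<alpha> w k i - y k i)))\<^sup>2)) \<and>
        \<not> ((\<forall>i\<in>{1..<n}. x k i = G i (x k n)) \<and> dual_sum n H G (y k) + y k n = 0) \<and>
        \<beta>_lo \<le> \<beta> k \<and> \<beta> k \<le> \<beta>_hi \<and>
        (let \<theta> = step_theta n H G \<gamma> (x k) (y k) (extrapolate \<alpha> z k, what n H G \<alpha> w k) in
           z (int k + 1) =
             extrapolate \<alpha> z k - (inverse \<gamma> * \<beta> k * \<theta>) *\<^sub>R (dual_sum n H G (y k) + y k n) \<and>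
           (\<forall>i\<in>{1..<n}.
              w (int k + 1) i =
                what n H G \<alpha> w k i - (\<beta> k * \<theta>) *\<^sub>R (x k i - G i (x k n)))))"

end

theory Submission
  imports Defs "HOL-Complex_Analysis.Great_Picard"
begin

text \<open>
  On the extended solution set the affine function \<open>\<phi>\<^sub>k\<close> is nonpositive by monotonicity, and each
  step is a relaxed projection of the extrapolated point onto a half-space \<open>\<phi>\<^sub>k \<le> 0\<close>. Hence the
  squared distance \<open>h\<^sub>k\<close> to any solution satisfies
  \<open>h\<^sub>k\<^sub>+\<^sub>1 - h\<^sub>k + Q\<^sub>k \<le> \<alpha>\<^sub>k (h\<^sub>k - h\<^sub>k\<^sub>-\<^sub>1) + \<delta>\<^sub>k\<close> with \<open>\<delta>\<^sub>k\<close> summable and \<open>Q\<^sub>k\<close> a multiple of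
  \<open>max(0, \<phi>\<^sub>k)\<^sup>2 / \<parallel>\<nabla>\<phi>\<^sub>k\<parallel>\<^sup>2\<close>; so \<open>h\<close> converges and \<open>Q\<close> is summable. The relative error criterion
  bounds \<open>\<phi>\<^sub>k\<close> below, and \<open>\<parallel>\<nabla>\<phi>\<^sub>k\<parallel>\<^sup>2\<close> above, by multiples of the squared residual
  \<open>\<Sum>\<^sub>i \<parallel>G\<^sub>i z - x\<^sub>i\<parallel>\<^sup>2 + \<parallel>y\<^sub>i - w\<^sub>i\<parallel>\<^sup>2\<close> at the extrapolated point, which therefore tends to \<open>0\<close>.
  Weak cluster points are then solutions by maximal monotonicity, and Opial's lemma applies.
\<close>

subsection \<open>Riesz representation and adjoints on complete subspaces\<close>

lemma bounded_linear_onD: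
  assumes "bounded_linear_on A B f"
  shows bounded_linear_on_mem: "u \<in> A \<Longrightarrow> f u \<in> B"
    and bounded_linear_on_add: "u \<in> A \<Longrightarrow> v \<in> A \<Longrightarrow> f (u + v) = f u + f v"
    and bounded_linear_on_scale: "u \<in> A \<Longrightarrow> f (c *\<^sub>R u) = c *\<^sub>R f u"
  using assms by (auto simp: bounded_linear_on_def)

lemma bounded_linear_on_diff:
  assumes "bounded_linear_on A B f" "subspace A" "u \<in> A" "v \<in> A"
  shows "f (u - v) = f u - f v"
  using bounded_linear_on_add[OF assms(1) assms(3), of "(-1) *\<^sub>R v"]
    bounded_linear_on_scale[OF assms(1) assms(4), of "-1"] subspace_scale[OF assms(2,4), of "-1"]
  by simp

lemma bounded_linear_on_bound:
  assumes "bounded_linear_on A B f"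
  obtains K where "K > 0" "\<And>u. u \<in> A \<Longrightarrow> norm (f u) \<le> K * norm u"
proof -
  obtain K where K: "\<And>u. u \<in> A \<Longrightarrow> norm (f u) \<le> K * norm u"
    using assms unfolding bounded_linear_on_def by blast
  have "norm (f u) \<le> (\<bar>K\<bar> + 1) * norm u" if "u \<in> A" for u
    using order_trans[OF K[OF that] mult_right_mono[of K "\<bar>K\<bar> + 1" "norm u"]] by simp
  then show ?thesis by (intro that[of "\<bar>K\<bar> + 1"]) auto
qed

lemma bounded_linear_on_tendsto:
  assumes f: "bounded_linear_on A B f" and A: "subspace A"
    and X: "\<And>n. X n \<in> A" "u \<in> A" "X \<longlonglongrightarrow> u"
  shows "(\<lambda>n. f (X n)) \<longlonglongrightarrow> f u"
proof -
  obtain K where K: "\<And>u. u \<in> A \<Longrightarrow> norm (f u) \<le> K * norm u"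
    using bounded_linear_on_bound[OF f] by blast
  have "(\<lambda>n. f (X n) - f u) \<longlonglongrightarrow> 0"
  proof (rule Lim_null_comparison)
    show "\<forall>\<^sub>F n in sequentially. norm (f (X n) - f u) \<le> K * norm (X n - u)"
      using K[OF subspace_diff[OF A X(1) X(2)]] bounded_linear_on_diff[OF f A X(1) X(2)] by simp
    show "(\<lambda>n. K * norm (X n - u)) \<longlonglongrightarrow> 0"
      using tendsto_mult_right_zero[OF tendsto_norm_zero[OF LIM_zero[OF X(3)]]] by simp
  qed
  then show ?thesis by (rule LIM_zero_cancel)
qed

text \<open>
  The representing vector minimises \<open>\<parallel>z\<parallel>\<^sup>2 - 2 f z\<close>; minimising sequences are Cauchy by the
  parallelogram law.
\<close>

lemma riesz_on:
  fixes A :: "'a::real_inner set" and f :: "'a \<Rightarrow> real"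
  assumes A: "hilbert_subspace A" and f: "bounded_linear_on A UNIV f"
  obtains u where "u \<in> A" "\<And>z. z \<in> A \<Longrightarrow> f z = inner z u"
proof -
  have sub: "subspace A" and comp: "complete A"
    using A by (auto simp: hilbert_subspace_def)
  obtain K where K: "\<And>u. u \<in> A \<Longrightarrow> norm (f u) \<le> K * norm u"
    using bounded_linear_on_bound[OF f] by blast
  define J where "J z = (norm z)\<^sup>2 - 2 * f z" for z
  define d where "d = Inf (J ` A)"
  have "J z \<ge> - K\<^sup>2" if "z \<in> A" for z
  \<comment> \<open>Since \<open>2 * f z\<close> is at most \<open>2 * K * norm z\<close>,
    \<open>J z\<close> dominates the quadratic in \<open>norm z\<close> equal to
    \<open>(norm z - K)\<^sup>2 - K\<^sup>2\<close>.\<close>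
  proof -
    have "0 \<le> (norm z - K)\<^sup>2" by simp
    then show ?thesis using K[OF that] by (simp add: J_def power2_diff algebra_simps)
  qed
  then have bdd: "bdd_below (J ` A)" by (intro bdd_belowI2) auto
  have ne: "J ` A \<noteq> {}" using subspace_0[OF sub] by auto
  have dle: "d \<le> J z" if "z \<in> A" for z
    unfolding d_def using bdd that by (intro cInf_lower) auto
  define q where "q n = inverse (real (Suc n))" for n
  have q: "q n > 0" for n by (simp add: q_def)
  have "\<exists>x\<in>A. J x < d + q n" for n
    using cInf_lessD[OF ne, of "d + q n"] q[of n] by (auto simp: d_def)
  then obtain X where X: "\<And>n. X n \<in> A" "\<And>n. J (X n) < d + q n"
    by metis
  \<comment> \<open>The linear parts cancel because \<open>f\<close> of the midpoint is the average
    of the two values; what remains is the parallelogram law.\<close>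
  have mid: "(norm (u - v))\<^sup>2 = 2 * (J u + J v - 2 * J ((1/2) *\<^sub>R (u + v)))"
    if "u \<in> A" "v \<in> A" for u v
  proof -
    have "f ((1/2) *\<^sub>R (u + v)) = (f u + f v) / 2"
      using bounded_linear_on_scale[OF f subspace_add[OF sub that]] bounded_linear_on_add[OF f that]
      by simp
    then show ?thesis
      by (simp add: J_def power2_norm_eq_inner inner_add inner_diff inner_commute algebra_simps)
  qed
  have gap: "(norm (X m - X n))\<^sup>2 \<le> 2 * (q m + q n)" for m n
    using mid[OF X(1) X(1), of m n] X(2)[of m] X(2)[of n]
      dle[OF subspace_scale[OF sub subspace_add[OF sub X(1) X(1)]], of "1/2" m n] by simp
  have "Cauchy X"
  proof (rule metric_CauchyI)
    fix r :: real assume r: "0 < r"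
    then obtain N where N: "q N < r\<^sup>2 / 4"
      using reals_Archimedean[of "r\<^sup>2 / 4"] by (auto simp: q_def)
    have "dist (X m) (X n) < r" if "N \<le> m" "N \<le> n" for m n
    proof -
      have "q m \<le> q N" "q n \<le> q N"
        using that by (auto simp: q_def intro!: le_imp_inverse_le)
      then have "2 * (q m + q n) < r\<^sup>2" using N by (simp add: field_simps)
      then have "(norm (X m - X n))\<^sup>2 < r\<^sup>2" by (rule order_le_less_trans[OF gap])
      then show ?thesis using r by (simp add: dist_norm power_less_imp_less_base)
    qed
    then show "\<exists>M. \<forall>m\<ge>M. \<forall>n\<ge>M. dist (X m) (X n) < r" by blast
  qed
  then obtain u where u: "u \<in> A" "X \<longlonglongrightarrow> u"
    using comp X(1) unfolding complete_def by metis
  have "(\<lambda>n. J (X n)) \<longlonglongrightarrow> J u"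
    unfolding J_def using bounded_linear_on_tendsto[OF f sub X(1) u] u by (intro tendsto_intros)
  moreover have "(\<lambda>n. d + q n) \<longlonglongrightarrow> d"
    using tendsto_add[OF tendsto_const[of d] LIMSEQ_inverse_real_of_nat] by (simp add: q_def)
  ultimately have Ju: "J u \<le> d"
    using X(2) by (intro LIMSEQ_le) (auto intro: less_imp_le)
  have "f z = inner z u" if z: "z \<in> A" for z
  proof -
    \<comment> \<open>The choice of \<open>t\<close> minimises the quadratic
      \<open>t\<^sup>2 * N + 2 * t * c\<close>, so its value \<open>- (c\<^sup>2 / N)\<close> must
      be nonnegative. The summand 1 in \<open>N\<close> keeps the divisor positive when
      \<open>z = 0\<close>.\<close>
    define c N t where "c = inner u z - f z" and "N = (norm z)\<^sup>2 + 1" and "t = - c / N"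
    have "N > 0" by (simp add: N_def add_nonneg_pos)
    have tz: "t *\<^sub>R z \<in> A" using subspace_scale[OF sub z] .
    have "(norm (u + t *\<^sub>R z))\<^sup>2 = (norm u)\<^sup>2 + t\<^sup>2 * (norm z)\<^sup>2 + 2 * t * inner u z"
      unfolding power2_norm_eq_inner
      by (simp add: inner_add inner_commute power2_eq_square algebra_simps)
    then have "J (u + t *\<^sub>R z) = J u + t\<^sup>2 * (norm z)\<^sup>2 + 2 * t * c"
      using bounded_linear_on_add[OF f u(1) tz] bounded_linear_on_scale[OF f z, of t]
      by (simp add: J_def c_def algebra_simps)
    then have "0 \<le> t\<^sup>2 * (norm z)\<^sup>2 + 2 * t * c"
      using dle[OF subspace_add[OF sub u(1) tz]] Ju by linarith
    also have "\<dots> \<le> t\<^sup>2 * N + 2 * t * c" by (simp add: N_def algebra_simps)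
    also have "\<dots> = - (c\<^sup>2 / N)"
      using \<open>N > 0\<close> by (simp add: t_def field_simps power2_eq_square)
    finally have "c = 0" using \<open>N > 0\<close> by (simp add: divide_le_0_iff)
    then show ?thesis by (simp add: c_def inner_commute)
  qed
  then show thesis using that u(1) by blast
qed

lemma inner_eq_on_imp_eq:
  assumes "subspace A" "u \<in> A" "v \<in> A" "\<And>z. z \<in> A \<Longrightarrow> inner z u = inner z v"
  shows "u = v"
proof -
  have "inner (u - v) (u - v) = 0"
    using assms(4)[OF subspace_diff[OF assms(1-3)]] by (simp only: inner_diff_right)
  then show ?thesis by simp
qed

text \<open>Here \<open>v\<close> is any vector of the ambient space. With \<open>f\<close> the
  identity, Riesz representation of this functional yields the orthogonal projection of
  \<open>v\<close> onto \<open>A\<close>.\<close>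

lemma bounded_linear_on_inner:
  assumes "bounded_linear_on A B f"
  shows "bounded_linear_on A UNIV (\<lambda>z. inner (f z) v)"
proof -
  obtain K where K: "\<And>u. u \<in> A \<Longrightarrow> norm (f u) \<le> K * norm u"
    using bounded_linear_on_bound[OF assms] by blast
  have "norm (inner (f u) v) \<le> (K * norm v) * norm u" if "u \<in> A" for u
    using order_trans[OF Cauchy_Schwarz_ineq2 mult_right_mono[OF K[OF that] norm_ge_zero, of v]]
    by (simp add: mult_ac)
  then show ?thesis
    using assms unfolding bounded_linear_on_def
    by (auto simp: inner_add_left)
qed

lemma bounded_linear_on_ident: "bounded_linear_on A A (\<lambda>z. z)"
  unfolding bounded_linear_on_def by (auto intro: exI[of _ 1])

text \<open>Riesz representation gives existence and testing against vectors of \<open>A\<close>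
  gives uniqueness, so the definite description in \<open>adjoint_on\<close> denotes.\<close>

lemma adjoint_on:
  assumes A: "hilbert_subspace A" and f: "bounded_linear_on A B f"
  shows adjoint_on_mem: "adjoint_on A f v \<in> A"
    and adjoint_on_inner: "z \<in> A \<Longrightarrow> inner (f z) v = inner z (adjoint_on A f v)"
proof -
  have sub: "subspace A" using A by (simp add: hilbert_subspace_def)
  obtain u where u: "u \<in> A" "\<And>z. z \<in> A \<Longrightarrow> inner (f z) v = inner z u"
    using riesz_on[OF A bounded_linear_on_inner[OF f]] by metis
  have "adjoint_on A f v \<in> A \<and> (\<forall>z\<in>A. inner (f z) v = inner z (adjoint_on A f v))"
    unfolding adjoint_on_def
  proof (rule theI)
    show "u \<in> A \<and> (\<forall>z\<in>A. inner (f z) v = inner z u)" using u by blast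
    show "u' = u" if "u' \<in> A \<and> (\<forall>z\<in>A. inner (f z) v = inner z u')" for u'
      using that u by (intro inner_eq_on_imp_eq[OF sub]) auto
  qed
  then show "adjoint_on A f v \<in> A" "z \<in> A \<Longrightarrow> inner (f z) v = inner z (adjoint_on A f v)" by auto
qed

lemma adjoint_on_diff:
  assumes A: "hilbert_subspace A" and f: "bounded_linear_on A B f"
  shows "adjoint_on A f (u - v) = adjoint_on A f u - adjoint_on A f v"
  using A adjoint_on_mem[OF A f]
  by (intro inner_eq_on_imp_eq[of A] subspace_diff)
     (auto simp: hilbert_subspace_def adjoint_on_inner[OF A f, symmetric] inner_diff_right)

text \<open>With \<open>u\<close> the adjoint vector, the squared norm of \<open>u\<close> equals
  the inner product of \<open>f u\<close> and \<open>v\<close>; Cauchy-Schwarz and division by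
  \<open>norm u\<close> finish the nonzero case.\<close>

lemma adjoint_on_bound:
  assumes A: "hilbert_subspace A" and f: "bounded_linear_on A B f"
    and K: "K \<ge> 0" "\<And>u. u \<in> A \<Longrightarrow> norm (f u) \<le> K * norm u"
  shows "norm (adjoint_on A f v) \<le> K * norm v"
proof (cases "adjoint_on A f v = 0")
  case True
  then show ?thesis
    using K(1) by simp
next
  case False
  let ?u = "adjoint_on A f v"
  have "norm ?u * norm ?u = inner (f ?u) v"
    using adjoint_on_inner[OF A f adjoint_on_mem[OF A f]]
    by (simp add: power2_eq_square[symmetric] power2_norm_eq_inner)
  also have "\<dots> \<le> norm (f ?u) * norm v"
    by (rule order_trans[OF abs_ge_self Cauchy_Schwarz_ineq2])
  also have "\<dots> \<le> (K * norm ?u) * norm v"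
    by (intro mult_right_mono K adjoint_on_mem[OF A f]) auto
  finally show ?thesis using False by (simp add: mult_ac)
qed

text \<open>Riesz representation reduces arbitrary bounded functionals to inner products with
  vectors of \<open>A\<close>, the form used in all later arguments.\<close>

lemma weakly_converges_on_iff:
  assumes A: "hilbert_subspace A"
  shows "weakly_converges_on A X l \<longleftrightarrow>
    range X \<subseteq> A \<and> l \<in> A \<and> (\<forall>v\<in>A. (\<lambda>k. inner (X k) v) \<longlonglongrightarrow> inner l v)"
proof (intro iffI conjI ballI)
  assume "weakly_converges_on A X l"
  then show "range X \<subseteq> A" "l \<in> A" "(\<lambda>k. inner (X k) v) \<longlonglongrightarrow> inner l v" for v
    using bounded_linear_on_inner[OF bounded_linear_on_ident, of A v]
    unfolding weakly_converges_on_def by auto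
next
  assume *: "range X \<subseteq> A \<and> l \<in> A \<and> (\<forall>v\<in>A. (\<lambda>k. inner (X k) v) \<longlonglongrightarrow> inner l v)"
  have "(\<lambda>k. f (X k)) \<longlonglongrightarrow> f l" if f: "bounded_linear_on A UNIV f" for f :: "'a \<Rightarrow> real"
  proof -
    obtain u where "u \<in> A" "\<And>z. z \<in> A \<Longrightarrow> f z = inner z u" using riesz_on[OF A f] by metis
    moreover have "X k \<in> A" for k using * by auto
    ultimately show ?thesis using * by simp
  qed
  then show "weakly_converges_on A X l" using * by (simp add: weakly_converges_on_def)
qed

subsection \<open>Weak convergence and Opial's lemma\<close>

lemma weakly_converges_onI:
  assumes "hilbert_subspace A" "\<And>k. X k \<in> A" "l \<in> A"
    "\<And>v. v \<in> A \<Longrightarrow> (\<lambda>k. inner (X k) v) \<longlonglongrightarrow> inner l v"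
  shows "weakly_converges_on A X l"
  using assms by (auto simp: weakly_converges_on_iff)

lemma weakly_converges_onD:
  assumes "weakly_converges_on A X l"
  shows weakly_converges_on_seq_mem: "X k \<in> A"
    and weakly_converges_on_limit_mem: "l \<in> A"
    and weakly_converges_on_inner:
      "hilbert_subspace A \<Longrightarrow> v \<in> A \<Longrightarrow> (\<lambda>k. inner (X k) v) \<longlonglongrightarrow> inner l v"
proof -
  show "X k \<in> A" "l \<in> A" using assms by (auto simp: weakly_converges_on_def)
  show "(\<lambda>k. inner (X k) v) \<longlonglongrightarrow> inner l v" if "hilbert_subspace A" "v \<in> A"
    using assms that by (simp add: weakly_converges_on_iff)
qed

lemma weakly_converges_on_subseq:
  assumes "weakly_converges_on A X l" "strict_mono r"
  shows "weakly_converges_on A (\<lambda>k. X (r k)) l"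
  using assms LIMSEQ_subseq_LIMSEQ[OF _ assms(2)]
  by (fastforce simp: weakly_converges_on_def o_def)

lemma weakly_converges_on_image:
  assumes A: "hilbert_subspace A" and B: "hilbert_subspace B" and f: "bounded_linear_on A B f"
    and X: "weakly_converges_on A X l"
  shows "weakly_converges_on B (\<lambda>k. f (X k)) (f l)"
proof (rule weakly_converges_onI[OF B])
  show "f (X k) \<in> B" for k
    using bounded_linear_on_mem[OF f weakly_converges_on_seq_mem[OF X]] .
  show "f l \<in> B"
    using bounded_linear_on_mem[OF f weakly_converges_on_limit_mem[OF X]] .
  show "(\<lambda>k. inner (f (X k)) v) \<longlonglongrightarrow> inner (f l) v" for v
    using X bounded_linear_on_inner[OF f, of v] by (auto simp: weakly_converges_on_def)
qed

text \<open>Transfers weak limits from the iterates to the extrapolated points and from these to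
  \<open>x\<close> and \<open>y\<close>, whose distances to the reference sequences vanish
  strongly.\<close>

lemma weakly_converges_on_add_null:
  assumes A: "hilbert_subspace A" and X: "weakly_converges_on A X l"
    and Y: "\<And>k. Y k \<in> A" and null: "(\<lambda>k. Y k - X k) \<longlonglongrightarrow> 0"
  shows "weakly_converges_on A Y l"
proof (rule weakly_converges_onI[OF A Y weakly_converges_on_limit_mem[OF X]])
  fix v assume "v \<in> A"
  then have "(\<lambda>k. inner (X k) v + inner (Y k - X k) v) \<longlonglongrightarrow> inner l v + inner 0 v"
    by (intro tendsto_intros null weakly_converges_on_inner[OF X A])
  then show "(\<lambda>k. inner (Y k) v) \<longlonglongrightarrow> inner l v" by (simp add: inner_diff_left)
qed

lemma weakly_converges_on_uminus:
  assumes A: "hilbert_subspace A" and X: "weakly_converges_on A X l"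
  shows "weakly_converges_on A (\<lambda>k. - X k) (- l)"
  using A weakly_converges_on_seq_mem[OF X] weakly_converges_on_limit_mem[OF X]
    weakly_converges_on_inner[OF X A]
  by (intro weakly_converges_onI) (auto simp: hilbert_subspace_def subspace_neg intro: tendsto_minus)

lemma weakly_converges_on_sum:
  assumes A: "hilbert_subspace A" and X: "\<And>i. i \<in> I \<Longrightarrow> weakly_converges_on A (\<lambda>k. X k i) (l i)"
  shows "weakly_converges_on A (\<lambda>k. \<Sum>i\<in>I. X k i) (\<Sum>i\<in>I. l i)"
  using A weakly_converges_on_seq_mem[OF X] weakly_converges_on_limit_mem[OF X]
    weakly_converges_on_inner[OF X A]
  by (intro weakly_converges_onI)
    (auto simp: hilbert_subspace_def inner_sum_left intro!: subspace_sum tendsto_sum)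

text \<open>A test vector \<open>v\<close> of \<open>A\<close> is moved across the adjoint and
  becomes the test vector \<open>f v\<close> of \<open>B\<close>.\<close>

lemma weakly_converges_on_adjoint:
  assumes A: "hilbert_subspace A" and B: "hilbert_subspace B" and f: "bounded_linear_on A B f"
    and X: "weakly_converges_on B X l"
  shows "weakly_converges_on A (\<lambda>k. adjoint_on A f (X k)) (adjoint_on A f l)"
proof (rule weakly_converges_onI[OF A adjoint_on_mem[OF A f] adjoint_on_mem[OF A f]])
  fix v assume v: "v \<in> A"
  have "inner (adjoint_on A f u) v = inner u (f v)" for u
    using adjoint_on_inner[OF A f v, of u] by (simp add: inner_commute)
  then show "(\<lambda>k. inner (adjoint_on A f (X k)) v) \<longlonglongrightarrow> inner (adjoint_on A f l) v"
    using weakly_converges_on_inner[OF X B bounded_linear_on_mem[OF f v]] by simp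
qed

section \<open>Weak sequential compactness of bounded sequences\<close>

text \<open>
  Along a diagonal subsequence the inner products with all members of the sequence converge; hence
  they converge on the complete subspace \<open>C\<close> of all vectors with this property, and vectors of
  \<open>A\<close> are replaced by their projections onto \<open>C\<close>.
\<close>

lemma bounded_imp_weakly_convergent_subseq:
  fixes X :: "nat \<Rightarrow> 'a::real_inner"
  assumes A: "hilbert_subspace A" and X: "\<And>k. X k \<in> A" and bdd: "bounded (range X)"
  obtains r l where "strict_mono r" "weakly_converges_on A (\<lambda>k. X (r k)) l"
proof -
  have sub: "subspace A" and comp: "complete A"
    using A by (auto simp: hilbert_subspace_def)
  obtain B where B: "\<And>k. norm (X k) \<le> B" using bdd by (auto simp: bounded_iff)
  have B0: "0 \<le> B" using order_trans[OF norm_ge_zero B] by blast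
  have bnd: "norm (inner (X k) v) \<le> B * norm v" for k v
    using order_trans[OF Cauchy_Schwarz_ineq2 mult_right_mono[OF B norm_ge_zero]] by simp
  have bnd': "norm (inner (X k) (X m)) \<le> B * B" for k m
    by (rule order_trans[OF bnd mult_left_mono[OF B B0]])
  \<comment> \<open>The second index \<open>m\<close> acts as the point of evaluation; there are
    countably many of them, so one subsequence serves all test vectors \<open>X m\<close>.\<close>
  obtain r where r: "strict_mono r" "\<And>m. \<exists>l. (\<lambda>k. inner (X (r k)) (X m)) \<longlonglongrightarrow> l"
    using function_convergent_subsequence[of UNIV "\<lambda>k m. inner (X k) (X m)" "B * B"] bnd' by auto
  define C where "C = {v \<in> A. convergent (\<lambda>k. inner (X (r k)) v)}"
  define L where "L v = lim (\<lambda>k. inner (X (r k)) v)" for v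
  have L: "(\<lambda>k. inner (X (r k)) v) \<longlonglongrightarrow> L v" if "v \<in> C" for v
    using that by (simp add: C_def L_def convergent_LIMSEQ_iff)
  have LI: "L v = c" if "(\<lambda>k. inner (X (r k)) v) \<longlonglongrightarrow> c" for v c
    using that by (simp add: L_def limI)
  have XC: "X m \<in> C" for m using X r(2)[of m] by (simp add: C_def convergent_def)
  have subC: "subspace C"
    unfolding subspace_def
    using subspace_0[OF sub] subspace_add[OF sub] subspace_scale[OF sub]
    by (auto simp: C_def inner_add_right convergent_const intro: convergent_add convergent_mult)
  have "closed C"
    unfolding closed_sequential_limits
  proof (intro allI impI, elim conjE)
    fix V v assume V: "\<forall>n. V n \<in> C" and lim: "V \<longlonglongrightarrow> v"
    have "v \<in> A"
      using complete_imp_closed[OF comp] V lim unfolding closed_sequential_limits C_def by blast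
    moreover have "Cauchy (\<lambda>k. inner (X (r k)) v)"
    proof (rule metric_CauchyI)
      fix \<epsilon> :: real assume \<epsilon>: "0 < \<epsilon>"
      \<comment> \<open>A three-epsilon argument: \<open>v\<close> is replaced by a nearby
        \<open>V N\<close> in \<open>C\<close>. Dividing by \<open>B + 1\<close> rather than
        \<open>B\<close> covers the case \<open>B = 0\<close>.\<close>
      have "0 < \<epsilon> / (3 * (B + 1))" using \<epsilon> B0 by simp
      then obtain N where N: "norm (V N - v) < \<epsilon> / (3 * (B + 1))"
        using LIMSEQ_D[OF lim] by blast
      have "norm (inner (X k) (v - V N)) < \<epsilon> / 3" for k
      proof -
        have "norm (inner (X k) (v - V N)) \<le> (B + 1) * norm (V N - v)"
          using order_trans[OF bnd[of k "v - V N"] mult_right_mono[of B "B + 1" "norm (v - V N)"]]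
          by (simp add: norm_minus_commute)
        also have "\<dots> < (B + 1) * (\<epsilon> / (3 * (B + 1)))"
          using N B0 by (intro mult_strict_left_mono) auto
        also have "\<dots> = \<epsilon> / 3" using B0 by (simp add: field_simps)
        finally show ?thesis .
      qed
      then have near: "dist (inner (X k) v) (inner (X k) (V N)) < \<epsilon> / 3" for k
        by (simp add: dist_norm inner_diff_right)
      have "Cauchy (\<lambda>k. inner (X (r k)) (V N))"
        using L V LIMSEQ_imp_Cauchy by blast
      then obtain M where M: "\<And>m n. m \<ge> M \<Longrightarrow> n \<ge> M \<Longrightarrow>
          dist (inner (X (r m)) (V N)) (inner (X (r n)) (V N)) < \<epsilon> / 3"
        using \<epsilon> metric_CauchyD[of _ "\<epsilon> / 3"] by (metis zero_less_divide_iff zero_less_numeral)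
      have "dist (inner (X (r m)) v) (inner (X (r n)) v) < \<epsilon>" if "m \<ge> M" "n \<ge> M" for m n
        using near[of "r m"] near[of "r n"] M[OF that] unfolding dist_real_def by linarith
      then show "\<exists>M. \<forall>m\<ge>M. \<forall>n\<ge>M. dist (inner (X (r m)) v) (inner (X (r n)) v) < \<epsilon>" by blast
    qed
    ultimately show "v \<in> C" by (simp add: C_def Cauchy_convergent_iff)
  qed
  then have C: "hilbert_subspace C"
    using subC complete_closed_subset[OF _ _ comp, of C] by (auto simp: hilbert_subspace_def C_def)
  have "norm (L v) \<le> B * norm v" if "v \<in> C" for v
    using tendsto_norm[OF L[OF that]] bnd by (intro LIMSEQ_le_const2) auto
  then have "bounded_linear_on C UNIV L"
    unfolding bounded_linear_on_def
    using tendsto_add[OF L L] tendsto_mult_left[OF L]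
    by (auto intro!: LI simp: inner_add_right)
  then obtain l where l: "l \<in> C" "\<And>v. v \<in> C \<Longrightarrow> L v = inner v l"
    using riesz_on[OF C] by metis
  have "(\<lambda>k. inner (X (r k)) v) \<longlonglongrightarrow> inner l v" for v
  proof -
    obtain v' where v': "v' \<in> C" "\<And>c. c \<in> C \<Longrightarrow> inner c v = inner c v'"
      using riesz_on[OF C bounded_linear_on_inner[OF bounded_linear_on_ident], of v] by metis
    have "inner (X (r k)) v' = inner (X (r k)) v" for k using v'(2)[OF XC] by simp
    moreover have "L v' = inner l v" using v' l by (simp add: inner_commute)
    ultimately show ?thesis using L[OF v'(1)] by simp
  qed
  then have "weakly_converges_on A (\<lambda>k. X (r k)) l"
    using X l(1) by (intro weakly_converges_onI[OF A]) (auto simp: C_def)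
  with r(1) show thesis by (rule that)
qed

text \<open>Subsequences are refined one index at a time; components treated earlier keep their weak
  limits under each further refinement.\<close>

lemma weakly_convergent_subseq_family:
  fixes U :: "nat \<Rightarrow> 'i \<Rightarrow> 'a::real_inner"
  assumes "finite I"
    and "\<And>i. i \<in> I \<Longrightarrow> hilbert_subspace (H i)"
    and "\<And>k i. i \<in> I \<Longrightarrow> U k i \<in> H i"
    and "\<And>i. i \<in> I \<Longrightarrow> bounded (range (\<lambda>k. U k i))"
  shows "\<exists>r l. strict_mono r \<and> (\<forall>i\<in>I. weakly_converges_on (H i) (\<lambda>k. U (r k) i) (l i))"
  using assms
proof (induction I rule: finite_induct)
  case empty
  then show ?case using strict_mono_id by blast
next
  case (insert j I)
  then obtain r l where r: "strict_mono r"
    and l: "\<And>i. i \<in> I \<Longrightarrow> weakly_converges_on (H i) (\<lambda>k. U (r k) i) (l i)"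
    by (metis insertI2)
  obtain s m where s: "strict_mono s" "weakly_converges_on (H j) (\<lambda>k. U (r (s k)) j) m"
    using bounded_imp_weakly_convergent_subseq[of "H j" "\<lambda>k. U (r k) j"] insert.prems
      bounded_subset[of "range (\<lambda>k. U k j)" "range (\<lambda>k. U (r k) j)"] by auto
  have "weakly_converges_on (H i) (\<lambda>k. U ((r \<circ> s) k) i) ((l(j := m)) i)" if "i \<in> insert j I" for i
    using weakly_converges_on_subseq[OF l s(1), of i] s(2) that insert.hyps by (auto simp: o_def)
  then show ?case using strict_mono_o[OF r s(1)] by blast
qed

text \<open>A convergent sequence of sums is bounded, and each nonnegative summand is at most the
  sum.\<close>

lemma bounded_if_weighted_distance_convergent:
  fixes U :: "nat \<Rightarrow> 'i \<Rightarrow> 'a::real_inner"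
  assumes fin: "finite I" and c: "\<And>i. i \<in> I \<Longrightarrow> c i > 0"
    and conv: "convergent (\<lambda>k. \<Sum>i\<in>I. c i * (norm (U k i - s i))\<^sup>2)" and i: "i \<in> I"
  shows "bounded (range (\<lambda>k. U k i))"
proof -
  obtain M where M: "\<And>k. (\<Sum>i\<in>I. c i * (norm (U k i - s i))\<^sup>2) \<le> M"
    using convergent_imp_Bseq[OF conv] by (auto simp: Bseq_def abs_le_iff)
  have "norm (U k i) \<le> norm (s i) + sqrt (M / c i)" for k
  proof -
    have "c i * (norm (U k i - s i))\<^sup>2 \<le> (\<Sum>i\<in>I. c i * (norm (U k i - s i))\<^sup>2)"
      using c by (intro member_le_sum i fin) (auto simp: less_imp_le)
    then have "(norm (U k i - s i))\<^sup>2 \<le> M / c i"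
      using M[of k] c[OF i] by (simp add: field_simps)
    then show ?thesis
      using real_le_rsqrt norm_triangle_sub[of "U k i" "s i"] by fastforce
  qed
  then show ?thesis by (auto simp: bounded_iff)
qed

text \<open>
  Opial's lemma: the inner products of the sequence with the difference of two weak cluster points
  in \<open>S\<close> converge, which forces the two cluster points to agree.
\<close>

lemma opial_family:
  fixes U :: "nat \<Rightarrow> 'i \<Rightarrow> 'a::real_inner"
  assumes fin: "finite I" and c: "\<And>i. i \<in> I \<Longrightarrow> c i > 0"
    and H: "\<And>i. i \<in> I \<Longrightarrow> hilbert_subspace (H i)"
    and U: "\<And>k i. i \<in> I \<Longrightarrow> U k i \<in> H i"
    and ne: "S \<noteq> {}"
    and conv: "\<And>s. s \<in> S \<Longrightarrow> convergent (\<lambda>k. \<Sum>i\<in>I. c i * (norm (U k i - s i))\<^sup>2)"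
    and cluster: "\<And>r l. strict_mono r \<Longrightarrow>
      (\<And>i. i \<in> I \<Longrightarrow> weakly_converges_on (H i) (\<lambda>k. U (r k) i) (l i)) \<Longrightarrow> l \<in> S"
  shows "\<exists>l\<in>S. \<forall>i\<in>I. weakly_converges_on (H i) (\<lambda>k. U k i) (l i)"
proof -
  obtain s where "s \<in> S" using ne by blast
  then have bnd: "bounded (range (\<lambda>k. U k i))" if "i \<in> I" for i
    using bounded_if_weighted_distance_convergent[OF fin c conv that] by blast
  obtain r l where r: "strict_mono r"
    and l: "\<And>i. i \<in> I \<Longrightarrow> weakly_converges_on (H i) (\<lambda>k. U (r k) i) (l i)"
    using weakly_convergent_subseq_family[of I H U, OF fin H U bnd] by blast
  have lS: "l \<in> S" using cluster[OF r l] .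
  have unique: "m i = l i" if s: "strict_mono s" and i: "i \<in> I"
    and m: "\<And>i. i \<in> I \<Longrightarrow> weakly_converges_on (H i) (\<lambda>k. U (s k) i) (m i)" for s m i
  proof -
    have mS: "m \<in> S" using cluster[OF s m] .
    define d where "d i = m i - l i" for i
    define P where "P k = (\<Sum>i\<in>I. c i * (inner (U k i) (d i)))" for k
    \<comment> \<open>Polarization: twice the inner product of \<open>U k i\<close> with
      \<open>m i - l i\<close> is the difference of the squared distances to \<open>l i\<close> and
      \<open>m i\<close>, up to a constant in \<open>k\<close>. Both weighted distance sums
      converge, hence so does \<open>P\<close>.\<close>
    have "P = (\<lambda>k. 1 / 2 * ((\<Sum>i\<in>I. c i * (norm (U k i - l i))\<^sup>2) - (\<Sum>i\<in>I. c i * (norm (U k i - m i))\<^sup>2)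
        + (\<Sum>i\<in>I. c i * ((norm (m i))\<^sup>2 - (norm (l i))\<^sup>2))))"
      unfolding P_def sum_subtractf[symmetric] sum.distrib[symmetric] sum_distrib_left d_def
      by (intro ext sum.cong)
        (auto simp: power2_norm_eq_inner inner_diff inner_commute field_simps)
    moreover have "convergent \<dots>"
      using conv[OF lS] conv[OF mS]
      by (intro convergent_mult convergent_add convergent_diff convergent_const) auto
    ultimately obtain p where p: "P \<longlonglongrightarrow> p" by (auto simp: convergent_def)
    have dH: "d i \<in> H i" if "i \<in> I" for i
      using H[OF that] weakly_converges_on_limit_mem[OF l[OF that]]
        weakly_converges_on_limit_mem[OF m[OF that]]
      by (auto simp: d_def hilbert_subspace_def intro: subspace_diff)
    have "(\<lambda>k. P (r k)) \<longlonglongrightarrow> (\<Sum>i\<in>I. c i * inner (l i) (d i))"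
      unfolding P_def by (intro tendsto_intros weakly_converges_on_inner[OF l H dH])
    then have 1: "p = (\<Sum>i\<in>I. c i * inner (l i) (d i))"
      using LIMSEQ_subseq_LIMSEQ[OF p r] LIMSEQ_unique by (auto simp: o_def)
    have "(\<lambda>k. P (s k)) \<longlonglongrightarrow> (\<Sum>i\<in>I. c i * inner (m i) (d i))"
      unfolding P_def by (intro tendsto_intros weakly_converges_on_inner[OF m H dH])
    then have 2: "p = (\<Sum>i\<in>I. c i * inner (m i) (d i))"
      using LIMSEQ_subseq_LIMSEQ[OF p s] LIMSEQ_unique by (auto simp: o_def)
    have "(\<Sum>i\<in>I. c i * inner (d i) (d i)) = 0"
      using 1 2 by (simp add: d_def inner_diff_left right_diff_distrib sum_subtractf)
    then have "c i * inner (d i) (d i) = 0"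
      using i c by (subst (asm) sum_nonneg_eq_0_iff[OF fin]) (auto simp: less_imp_le)
    then show ?thesis using c[OF i] by (simp add: d_def)
  qed
  have "weakly_converges_on (H i) (\<lambda>k. U k i) (l i)" if i: "i \<in> I" for i
  proof (rule weakly_converges_onI[OF H[OF i] U[OF i] weakly_converges_on_limit_mem[OF l[OF i]]])
    fix v assume v: "v \<in> H i"
    show "(\<lambda>k. inner (U k i) v) \<longlonglongrightarrow> inner (l i) v"
    proof (rule ccontr)
      \<comment> \<open>A subsequence staying \<open>\<epsilon>\<close> away would, by boundedness,
        have a weakly convergent refinement, whose limit must be \<open>l\<close> by
        \<open>unique\<close>.\<close>
      assume "\<not> (\<lambda>k. inner (U k i) v) \<longlonglongrightarrow> inner (l i) v"
      then obtain \<epsilon> where \<epsilon>: "\<epsilon> > 0"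
        and "\<not> (\<forall>\<^sub>F k in sequentially. dist (inner (U k i) v) (inner (l i) v) < \<epsilon>)"
        by (auto simp: tendsto_iff)
      then have "\<exists>\<^sub>\<infinity>k. dist (inner (U k i) v) (inner (l i) v) \<ge> \<epsilon>"
        by (simp add: frequently_def not_le cofinite_eq_sequentially)
      then obtain s :: "nat \<Rightarrow> nat" where s: "strict_mono s"
        and far: "\<And>k. dist (inner (U (s k) i) v) (inner (l i) v) \<ge> \<epsilon>"
        using infinite_enumerate[of "{k. dist (inner (U k i) v) (inner (l i) v) \<ge> \<epsilon>}"]
        by (auto simp: INFM_iff_infinite)
      obtain t m where t: "strict_mono t"
        and m: "\<And>j. j \<in> I \<Longrightarrow> weakly_converges_on (H j) (\<lambda>k. U (s (t k)) j) (m j)"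
        using weakly_convergent_subseq_family[of I H "\<lambda>k. U (s k)"] fin H U
          bounded_subset[OF bnd, of _ "range (\<lambda>k. U (s k) _)"] by blast
      have "m i = l i"
        using unique[OF strict_mono_o[OF s t] i] m by (simp add: o_def)
      then have "(\<lambda>k. inner (U (s (t k)) i) v) \<longlonglongrightarrow> inner (l i) v"
        using weakly_converges_on_inner[OF m[OF i] H[OF i] v] by simp
      then obtain k where "dist (inner (U (s (t k)) i) v) (inner (l i) v) < \<epsilon>"
        using \<epsilon> LIMSEQ_iff_nz by (metis lim_sequentially order_refl)
      then show False using far[of "t k"] by simp
    qed
  qed
  with lS show ?thesis by blast
qed

subsection \<open>Inertial quasi-Fejer sequences\<close>

text \<open>The positive parts \<open>t\<close> of the increments of \<open>h\<close> contract by
  the factor \<open>a < 1\<close> up to the summable error \<open>\<delta>\<close>, so they are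
  summable. Subtracting their partial sums from \<open>h\<close> leaves a decreasing sequence
  bounded below.\<close>

lemma inertial_quasi_fejer:
  fixes h Q \<alpha> \<delta> :: "nat \<Rightarrow> real"
  assumes h: "\<And>k. 0 \<le> h k" and Q: "\<And>k. 0 \<le> Q k" and \<delta>: "\<And>k. 0 \<le> \<delta> k" "summable \<delta>"
    and \<alpha>: "\<And>k. 0 \<le> \<alpha> k" "\<And>k. \<alpha> k \<le> a" "a < 1"
    and rec: "\<And>k. h (Suc (Suc k)) - h (Suc k) + Q k \<le> \<alpha> k * (h (Suc k) - h k) + \<delta> k"
  shows "convergent h" and "summable Q"
proof -
  define t where "t k = max 0 (h (Suc k) - h k)" for k
  have t: "0 \<le> t k" for k by (simp add: t_def)
  have a: "0 \<le> a" using order_trans[OF \<alpha>(1,2)] .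
  have "\<alpha> k * (h (Suc k) - h k) \<le> a * t k" for k
    using mult_left_mono[of "h (Suc k) - h k" "t k" "\<alpha> k"] mult_right_mono[OF \<alpha>(2) t, of k k] \<alpha>(1)[of k]
    by (simp add: t_def)
  then have rec': "h (Suc (Suc k)) - h (Suc k) + Q k \<le> a * t k + \<delta> k" for k
    using rec[of k] by (meson add_right_mono order_trans)
  \<comment> \<open>The right-hand side is nonnegative, so the bound on the increment also bounds
    its positive part.\<close>
  have tS: "t (Suc k) \<le> a * t k + \<delta> k" for k
    using rec'[of k] Q[of k] mult_nonneg_nonneg[OF a t[of k]] \<delta>(1)[of k]
    unfolding t_def[of "Suc k"] by linarith
  have step: "(\<Sum>k<Suc N. t k) \<le> t 0 + a * (\<Sum>k<N. t k) + (\<Sum>k<N. \<delta> k)" for N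
    using sum_mono[of "{..<N}" "\<lambda>k. t (Suc k)" "\<lambda>k. a * t k + \<delta> k"] tS
    by (subst sum.lessThan_Suc_shift) (simp add: sum.distrib sum_distrib_left)
  have bound: "(\<Sum>k<N. t k) \<le> (t 0 + suminf \<delta>) / (1 - a)" for N
  proof -
    \<comment> \<open>The same partial sum of \<open>t\<close> stands on both sides, on the right
      with factor \<open>a\<close>; \<open>a < 1\<close> allows solving for it.\<close>
    have "(\<Sum>k<N. t k) \<le> t 0 + a * (\<Sum>k<N. t k) + suminf \<delta>"
      using step[of N] t[of N] sum_le_suminf[OF \<delta>(2), of "{..<N}"] \<delta>(1) by simp
    then show ?thesis using \<alpha>(3) by (simp add: field_simps)
  qed
  then have st: "summable t"
    using t by (intro summableI_nonneg_bounded) auto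
  define v where "v k = h k - (\<Sum>j<k. t j)" for k
  have "decseq v"
    by (intro decseq_SucI) (simp add: v_def t_def)
  moreover have "- ((t 0 + suminf \<delta>) / (1 - a)) \<le> v k" for k
    using bound[of k] h[of k] by (simp add: v_def)
  ultimately have "convergent v"
    using decseq_convergent[of v] by (metis convergent_def)
  moreover have "convergent (\<lambda>k. \<Sum>j<k. t j)"
    using st by (simp add: summable_iff_convergent)
  ultimately have "convergent (\<lambda>k. v k + (\<Sum>j<k. t j))"
    by (rule convergent_add)
  then show conv: "convergent h" by (simp add: v_def)
  then obtain L where "h \<longlonglongrightarrow> L" by (auto simp: convergent_def)
  \<comment> \<open>\<open>Q\<close> is dominated by a telescoping series plus the summable terms on
    the right of \<open>rec'\<close>.\<close>
  then have "summable (\<lambda>k. h (Suc k) - h (Suc (Suc k)))"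
    using telescope_summable'[of "\<lambda>k. h (Suc k)" L] LIMSEQ_Suc by blast
  then have "summable (\<lambda>k. (h (Suc k) - h (Suc (Suc k))) + (a * t k + \<delta> k))"
    by (intro summable_add summable_mult st \<delta>)
  then show "summable Q"
  proof (rule summable_comparison_test'[where N = 0])
    show "norm (Q k) \<le> (h (Suc k) - h (Suc (Suc k))) + (a * t k + \<delta> k)" for k
      using rec'[of k] Q[of k] by simp
  qed
qed

subsection \<open>Maximal monotone operators and projection steps\<close>

lemma maximal_monotone_opD:
  assumes "maximal_monotone_op A T" "x \<in> A" "y \<in> T x"
  shows maximal_monotone_op_mem: "y \<in> A"
    and maximal_monotone_op_mono: "x' \<in> A \<Longrightarrow> y' \<in> T x' \<Longrightarrow> 0 \<le> inner (x - x') (y - y')"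
  using assms unfolding maximal_monotone_op_def monotone_op_def op_graph_def by fastforce+

text \<open>Adjoining the single pair \<open>(x, y)\<close> to the graph gives a monotone extension,
  which by maximality is no larger.\<close>

lemma maximal_monotone_op_maximal:
  assumes T: "maximal_monotone_op A T" and xy: "x \<in> A" "y \<in> A"
    and mono: "\<And>x' y'. x' \<in> A \<Longrightarrow> y' \<in> T x' \<Longrightarrow> 0 \<le> inner (x - x') (y - y')"
  shows "y \<in> T x"
proof -
  define T' where "T' = T(x := insert y (T x))"
  have graph: "op_graph A T' = insert (x, y) (op_graph A T)"
    using xy by (auto simp: op_graph_def T'_def split: if_splits)
  have "0 \<le> inner (x' - x) (y' - y)" if "(x', y') \<in> op_graph A T" for x' y'
    using mono[of x' y'] that
    by (simp add: op_graph_def inner_diff_left inner_diff_right algebra_simps)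
  then have "monotone_op A T'"
    using T xy mono unfolding monotone_op_def maximal_monotone_op_def graph
    by (auto simp: op_graph_def)
  then have "op_graph A T' = op_graph A T"
    using T graph unfolding maximal_monotone_op_def by blast
  then show ?thesis using graph by (auto simp: op_graph_def)
qed

text \<open>
  A component outside its graph has a test pair with negative product, and a component inside its
  graph serves as its own test pair.
\<close>

lemma maximal_monotone_op_family:
  assumes fin: "finite I" and T: "\<And>i. i \<in> I \<Longrightarrow> maximal_monotone_op (A i) (T i)"
    and mem: "\<And>i. i \<in> I \<Longrightarrow> x i \<in> A i" "\<And>i. i \<in> I \<Longrightarrow> y i \<in> A i"
    and mono: "\<And>x' y'. (\<And>i. i \<in> I \<Longrightarrow> x' i \<in> A i \<and> y' i \<in> T i (x' i)) \<Longrightarrow>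
      0 \<le> (\<Sum>i\<in>I. inner (x i - x' i) (y i - y' i))"
    and j: "j \<in> I"
  shows "y j \<in> T j (x j)"
proof (rule ccontr)
  assume not: "y j \<notin> T j (x j)"
  have "\<exists>a b. a \<in> A i \<and> b \<in> T i a \<and> inner (x i - a) (y i - b) \<le> 0 \<and>
      (y i \<notin> T i (x i) \<longrightarrow> inner (x i - a) (y i - b) < 0)" if i: "i \<in> I" for i
  proof (cases "y i \<in> T i (x i)")
    case True
    then show ?thesis using mem(1)[OF i] by (intro exI[of _ "x i"] exI[of _ "y i"]) auto
  next
    case False
    then show ?thesis
      using maximal_monotone_op_maximal[OF T[OF i] mem(1)[OF i] mem(2)[OF i]]
      by (meson not_le less_imp_le)
  qed
  then obtain a b where ab: "\<And>i. i \<in> I \<Longrightarrow> a i \<in> A i \<and> b i \<in> T i (a i)"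
    and le: "\<And>i. i \<in> I \<Longrightarrow> inner (x i - a i) (y i - b i) \<le> 0"
    and less: "inner (x j - a j) (y j - b j) < 0"
    using not j by metis
  have "(\<Sum>i\<in>I. inner (x i - a i) (y i - b i)) < (\<Sum>i\<in>I. 0)"
    by (rule sum_strict_mono_ex1) (use fin le less j in auto)
  with mono[of a b] ab show False by simp
qed

section \<open>Norm identities and estimates for a single iteration\<close>

text \<open>The extrapolated point is the affine combination of \<open>u\<close> and
  \<open>v\<close> with coefficients \<open>1 + \<alpha>\<close> and \<open>- \<alpha>\<close>; this
  is the squared-norm identity for such combinations.\<close>

lemma norm_extrapolate:
  fixes u v s :: "'a::real_inner"
  shows "(norm (u + \<alpha> *\<^sub>R (u - v) - s))\<^sup>2 =
    (1 + \<alpha>) * (norm (u - s))\<^sup>2 - \<alpha> * (norm (v - s))\<^sup>2 + \<alpha> * (1 + \<alpha>) * (norm (u - v))\<^sup>2"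
  unfolding power2_norm_eq_inner
  by (simp add: inner_add inner_diff inner_commute algebra_simps)

text \<open>With \<open>\<theta> = max 0 \<phi> / N\<close>, the quadratic term of the expanded
  square is \<open>b\<^sup>2 * \<theta> * max 0 \<phi>\<close>, while the cross term lowers the
  distance by at least \<open>2 * b * \<theta> * max 0 \<phi>\<close>. The weights \<open>c\<close>
  allow for the \<gamma>-inner product.\<close>

lemma relaxed_projection_step:
  fixes u s g :: "'i \<Rightarrow> 'a::real_inner"
  assumes N: "N = (\<Sum>i\<in>I. c i * (norm (g i))\<^sup>2)" "N > 0" and b: "0 \<le> b"
    and \<phi>: "\<phi> \<le> (\<Sum>i\<in>I. c i * inner (u i - s i) (g i))"
  shows "(\<Sum>i\<in>I. c i * (norm (u i - (b * (max 0 \<phi> / N)) *\<^sub>R g i - s i))\<^sup>2)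
      + b * (2 - b) * ((max 0 \<phi>)\<^sup>2 / N) \<le> (\<Sum>i\<in>I. c i * (norm (u i - s i))\<^sup>2)"
proof -
  define \<theta> where "\<theta> = max 0 \<phi> / N"
  have \<theta>0: "0 \<le> \<theta>" using N(2) by (simp add: \<theta>_def)
  have \<theta>N: "\<theta> * N = max 0 \<phi>" using N(2) by (simp add: \<theta>_def)
  have expand: "(norm (u i - (b * \<theta>) *\<^sub>R g i - s i))\<^sup>2 =
    (norm (u i - s i))\<^sup>2 - 2 * (b * \<theta>) * inner (u i - s i) (g i) + (b * \<theta>)\<^sup>2 * (norm (g i))\<^sup>2" for i
    unfolding power2_norm_eq_inner
    by (simp add: power2_eq_square inner_add inner_diff inner_commute algebra_simps)
  have "(\<Sum>i\<in>I. c i * (norm (u i - (b * \<theta>) *\<^sub>R g i - s i))\<^sup>2) =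
    (\<Sum>i\<in>I. c i * (norm (u i - s i))\<^sup>2 - 2 * (b * \<theta>) * (c i * inner (u i - s i) (g i))
       + (b * \<theta>)\<^sup>2 * (c i * (norm (g i))\<^sup>2))"
    unfolding expand by (intro sum.cong refl) (simp add: algebra_simps)
  also have "\<dots> = (\<Sum>i\<in>I. c i * (norm (u i - s i))\<^sup>2)
      - 2 * (b * \<theta>) * (\<Sum>i\<in>I. c i * inner (u i - s i) (g i)) + (b * \<theta>)\<^sup>2 * N"
    by (simp add: sum.distrib sum_subtractf sum_distrib_left N(1))
  also have "(b * \<theta>)\<^sup>2 * N = b\<^sup>2 * (\<theta> * max 0 \<phi>)"
    by (simp add: \<theta>N[symmetric] power2_eq_square algebra_simps)
  finally have eq: "(\<Sum>i\<in>I. c i * (norm (u i - (b * \<theta>) *\<^sub>R g i - s i))\<^sup>2) =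
    (\<Sum>i\<in>I. c i * (norm (u i - s i))\<^sup>2)
      - 2 * (b * \<theta>) * (\<Sum>i\<in>I. c i * inner (u i - s i) (g i)) + b\<^sup>2 * (\<theta> * max 0 \<phi>)" .
  \<comment> \<open>If \<phi> is negative, \<theta> vanishes, so the maximum may be dropped next to
    \<theta>.\<close>
  have "\<theta> * max 0 \<phi> = \<theta> * \<phi>" by (simp add: \<theta>_def max_def)
  also have "\<dots> \<le> \<theta> * (\<Sum>i\<in>I. c i * inner (u i - s i) (g i))"
    by (rule mult_left_mono[OF \<phi> \<theta>0])
  finally have le: "\<theta> * max 0 \<phi> \<le> \<theta> * (\<Sum>i\<in>I. c i * inner (u i - s i) (g i))" .
  have "2 * b * (\<theta> * max 0 \<phi>) \<le> 2 * (b * \<theta>) * (\<Sum>i\<in>I. c i * inner (u i - s i) (g i))"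
    using mult_left_mono[OF le, of "2 * b"] b by (simp only: mult.assoc)
  moreover have "(max 0 \<phi>)\<^sup>2 / N = \<theta> * max 0 \<phi>"
    by (simp add: \<theta>_def power2_eq_square)
  ultimately show ?thesis
    unfolding \<theta>_def[symmetric] eq by (simp add: power2_eq_square algebra_simps)
qed

text \<open>Expanding the square of \<open>e = \<rho> *\<^sub>R b - a\<close> isolates
  \<open>2 * \<rho> * inner a b\<close>; the error bound absorbs the fraction
  \<open>\<sigma>\<^sup>2\<close> of the squares. Dividing by \<rho> explains the two entries of the
  minimum.\<close>

lemma error_criterion_bound:
  fixes a b e :: "'a::real_inner"
  assumes \<rho>: "0 < \<rho>_lo" "\<rho>_lo \<le> \<rho>" "\<rho> \<le> \<rho>_hi" and \<sigma>: "0 \<le> \<sigma>" "\<sigma> < 1" and e: "e = \<rho> *\<^sub>R b - a"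
    and err: "(norm e)\<^sup>2 \<le> \<sigma>\<^sup>2 * ((norm a)\<^sup>2 + (norm (\<rho> *\<^sub>R b))\<^sup>2)"
  shows "(1 - \<sigma>\<^sup>2) / 2 * min (1 / \<rho>_hi) \<rho>_lo * ((norm a)\<^sup>2 + (norm b)\<^sup>2) \<le> inner a b"
proof -
  have \<rho>0: "0 < \<rho>" using \<rho> by linarith
  have \<sigma>2: "0 \<le> (1 - \<sigma>\<^sup>2) / 2" using \<sigma> by (simp add: power_le_one)
  have "(norm e)\<^sup>2 = (norm a)\<^sup>2 + \<rho>\<^sup>2 * (norm b)\<^sup>2 - 2 * \<rho> * inner a b"
    unfolding e power2_norm_eq_inner
    by (simp add: power2_eq_square inner_diff inner_commute algebra_simps)
  moreover have "(norm e)\<^sup>2 \<le> \<sigma>\<^sup>2 * ((norm a)\<^sup>2 + \<rho>\<^sup>2 * (norm b)\<^sup>2)"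
    using err by (simp add: power_mult_distrib)
  ultimately have "((norm a)\<^sup>2 + \<rho>\<^sup>2 * (norm b)\<^sup>2) - \<sigma>\<^sup>2 * ((norm a)\<^sup>2 + \<rho>\<^sup>2 * (norm b)\<^sup>2)
      \<le> 2 * (\<rho> * inner a b)" by linarith
  then have "(1 - \<sigma>\<^sup>2) / 2 * ((norm a)\<^sup>2 + \<rho>\<^sup>2 * (norm b)\<^sup>2) \<le> \<rho> * inner a b"
    by (simp add: left_diff_distrib)
  then have main: "(1 - \<sigma>\<^sup>2) / 2 * ((norm a)\<^sup>2 / \<rho> + \<rho> * (norm b)\<^sup>2) \<le> inner a b"
    using \<rho>0 by (simp add: field_simps power2_eq_square)
  have "min (1 / \<rho>_hi) \<rho>_lo \<le> 1 / \<rho>" "min (1 / \<rho>_hi) \<rho>_lo \<le> \<rho>"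
    using \<rho> \<rho>0 by (auto simp: min_le_iff_disj intro: divide_left_mono frac_le)
  then have "min (1 / \<rho>_hi) \<rho>_lo * ((norm a)\<^sup>2 + (norm b)\<^sup>2) \<le> (norm a)\<^sup>2 / \<rho> + \<rho> * (norm b)\<^sup>2"
    using mult_right_mono[of "min (1 / \<rho>_hi) \<rho>_lo" "1 / \<rho>" "(norm a)\<^sup>2"]
      mult_right_mono[of "min (1 / \<rho>_hi) \<rho>_lo" \<rho> "(norm b)\<^sup>2"]
    by (simp only: distrib_left) simp
  from mult_left_mono[OF this \<sigma>2] main show ?thesis by (simp only: mult.assoc)
qed

subsection \<open>The separator and the extended solution set\<close>

lemma sum_lessThan_split_0:
  fixes f :: "nat \<Rightarrow> 'b::comm_monoid_add"
  assumes "0 < n"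
  shows "(\<Sum>i<n. f i) = f 0 + (\<Sum>i=1..<n. f i)"
proof -
  have "{..<n} = insert 0 {1..<n}" using assms by auto
  then show ?thesis by simp
qed

lemma sum_atLeast1_split_last:
  fixes f :: "nat \<Rightarrow> 'b::comm_monoid_add"
  assumes "0 < n"
  shows "(\<Sum>i=Suc 0..n. f i) = (\<Sum>i=Suc 0..<n. f i) + f n"
proof -
  have "{Suc 0..n} = insert n {Suc 0..<n}" using assms by auto
  then show ?thesis by (simp add: add.commute)
qed

locale splitting =
  fixes n :: nat and H :: "nat \<Rightarrow> 'a::real_inner set" and T :: "nat \<Rightarrow> 'a \<Rightarrow> 'a set"
    and G :: "nat \<Rightarrow> 'a \<Rightarrow> 'a"
  assumes problem: "splitting_problem n H T G"
begin

abbreviation "D \<equiv> dual_sum n H G"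

lemma n_ge: "2 \<le> n" and H_last: "H n = H 0" and G_last: "z \<in> H 0 \<Longrightarrow> G n z = z"
  using problem by (auto simp: splitting_problem_def)

lemma H_hilbert: "i \<le> n \<Longrightarrow> hilbert_subspace (H i)"
  using problem by (auto simp: splitting_problem_def)

lemma H_subspace: "i \<le> n \<Longrightarrow> subspace (H i)"
  using H_hilbert by (auto simp: hilbert_subspace_def)

lemma T_maximal: "1 \<le> i \<Longrightarrow> i \<le> n \<Longrightarrow> maximal_monotone_op (H i) (T i)"
  and G_linear: "1 \<le> i \<Longrightarrow> i \<le> n \<Longrightarrow> bounded_linear_on (H 0) (H i) (G i)"
  using problem by (auto simp: splitting_problem_def)

lemma G_mem: "1 \<le> i \<Longrightarrow> i \<le> n \<Longrightarrow> z \<in> H 0 \<Longrightarrow> G i z \<in> H i"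
  using bounded_linear_on_mem[OF G_linear] .

lemma H0_hilbert: "hilbert_subspace (H 0)"
  by (rule H_hilbert) simp

lemma G_bound:
  obtains K where "1 \<le> K"
    "\<And>i u. 1 \<le> i \<Longrightarrow> i \<le> n \<Longrightarrow> u \<in> H 0 \<Longrightarrow> norm (G i u) \<le> K * norm u"
    "\<And>i v. 1 \<le> i \<Longrightarrow> i \<le> n \<Longrightarrow> norm (adjoint_on (H 0) (G i) v) \<le> K * norm v"
proof -
  have "\<exists>K>0. \<forall>u\<in>H 0. norm (G i u) \<le> K * norm u" if "1 \<le> i" "i \<le> n" for i
    using bounded_linear_on_bound[OF G_linear[OF that]] by metis
  then obtain k where k: "\<And>i. 1 \<le> i \<Longrightarrow> i \<le> n \<Longrightarrow> 0 < k i"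
    "\<And>i u. 1 \<le> i \<Longrightarrow> i \<le> n \<Longrightarrow> u \<in> H 0 \<Longrightarrow> norm (G i u) \<le> k i * norm u" by metis
  define K where "K = 1 + (\<Sum>i=1..n. k i)"
  have kK: "k i \<le> K" if "1 \<le> i" "i \<le> n" for i
    using member_le_sum[of i "{1..n}" k] k(1) that by (force simp: K_def less_imp_le)
  have K1: "1 \<le> K" using k(1) by (auto simp: K_def less_imp_le intro!: sum_nonneg)
  have GK: "norm (G i u) \<le> K * norm u" if "1 \<le> i" "i \<le> n" "u \<in> H 0" for i u
    using order_trans[OF k(2)[OF that] mult_right_mono[OF kK[OF that(1,2)] norm_ge_zero]] .
  moreover have "norm (adjoint_on (H 0) (G i) v) \<le> K * norm v" if "1 \<le> i" "i \<le> n" for i v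
    using adjoint_on_bound[OF H0_hilbert G_linear[OF that], of K] GK[OF that] K1 by simp
  ultimately show thesis using K1 by (intro that)
qed

lemma dual_sum_mem: "D w \<in> H 0"
  unfolding dual_sum_def
  by (intro subspace_sum H_subspace adjoint_on_mem[OF H0_hilbert G_linear]) auto

lemma inner_dual_sum:
  assumes "z \<in> H 0"
  shows "inner z (D w) = (\<Sum>i=1..<n. inner (G i z) (w i))"
  unfolding dual_sum_def inner_sum_right
  by (intro sum.cong refl adjoint_on_inner[OF H0_hilbert G_linear assms, symmetric]) auto

lemma dual_sum_diff: "D (\<lambda>i. u i - v i) = D u - D v"
  unfolding dual_sum_def sum_subtractf[symmetric]
  by (intro sum.cong refl adjoint_on_diff[OF H0_hilbert G_linear]) auto

lemma dual_sum_cong: "(\<And>i. 1 \<le> i \<Longrightarrow> i < n \<Longrightarrow> u i = v i) \<Longrightarrow> D u = D v"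
  unfolding dual_sum_def by (intro sum.cong refl arg_cong[where f = "adjoint_on _ _"]) auto

lemma dual_sum_with_last: "D (with_last n H G w) = D w"
  by (intro dual_sum_cong) (auto simp: with_last_def)

lemma with_last_mem:
  assumes "\<And>i. 1 \<le> i \<Longrightarrow> i < n \<Longrightarrow> w i \<in> H i" "1 \<le> i" "i \<le> n"
  shows "with_last n H G w i \<in> H i"
  using assms subspace_neg[OF H_subspace[of 0] dual_sum_mem] H_last
  by (cases "i = n") (auto simp: with_last_def)

text \<open>The convention for the last dual component turns the exceptional term of the separator
  into an ordinary block, so all \<open>n\<close> blocks can be treated alike.\<close>

lemma separator_eq_sum:
  assumes "zz \<in> H 0"
  shows "separator n H G x y (zz, w) = (\<Sum>i=1..n. inner (G i zz - x i) (y i - with_last n H G w i))"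
  using n_ge by (simp add: separator_def sum_atLeast1_split_last with_last_def)

text \<open>The products of \<open>G i zz\<close> with \<open>w i\<close> from the first
  \<open>n - 1\<close> blocks cancel against the product of \<open>zz\<close> with the dual sum in
  the last block. What remains is affine in \<open>(zz, w)\<close>.\<close>

lemma separator_affine:
  assumes zz: "zz \<in> H 0" and x: "x n \<in> H 0"
  shows "separator n H G x y (zz, w) =
    inner zz (D y + y n) + (\<Sum>i=1..<n. inner (w i) (x i - G i (x n))) - (\<Sum>i=1..n. inner (x i) (y i))"
proof -
  have "inner zz (D y + y n) + (\<Sum>i=1..<n. inner (w i) (x i - G i (x n))) - (\<Sum>i=1..n. inner (x i) (y i))
    = inner zz (y n) - inner (x n) (y n) + (\<Sum>i=1..<n. inner (G i zz) (y i) + inner (w i) (x i)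
        - inner (w i) (G i (x n)) - inner (x i) (y i))"
    using n_ge
    by (simp add: inner_add_right inner_dual_sum[OF zz] sum_atLeast1_split_last inner_diff_right
        sum.distrib sum_subtractf)
  also have "\<dots> = separator n H G x y (zz, w)"
    using G_last[OF zz]
    by (simp add: separator_def inner_add_right inner_diff inner_dual_sum[OF zz] inner_dual_sum[OF x]
        sum.distrib sum_subtractf inner_commute)
  finally show ?thesis by simp
qed

lemma separator_nonpos:
  assumes s: "(zz, w) \<in> extended_solution_set n H T G"
    and x: "\<And>i. 1 \<le> i \<Longrightarrow> i \<le> n \<Longrightarrow> x i \<in> H i" and y: "\<And>i. 1 \<le> i \<Longrightarrow> i \<le> n \<Longrightarrow> y i \<in> T i (x i)"
  shows "separator n H G x y (zz, w) \<le> 0"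
proof -
  have zz: "zz \<in> H 0" using s by (simp add: extended_solution_set_def prod_space_def)
  have wT: "with_last n H G w i \<in> T i (G i zz)" if "1 \<le> i" "i \<le> n" for i
    using s that G_last[OF zz] by (auto simp: extended_solution_set_def with_last_def)
  have "inner (G i zz - x i) (y i - with_last n H G w i) \<le> 0" if "1 \<le> i" "i \<le> n" for i
    using maximal_monotone_op_mono[OF T_maximal[OF that] G_mem[OF that zz] wT[OF that] x[OF that] y[OF that]]
    by (simp add: inner_diff_right)
  then show ?thesis unfolding separator_eq_sum[OF zz] by (intro sum_nonpos) auto
qed

lemma extended_solution_setI:
  assumes zz: "zz \<in> H 0" and w: "\<And>i. 1 \<le> i \<Longrightarrow> i < n \<Longrightarrow> w i \<in> H i"
    and T: "\<And>i. 1 \<le> i \<Longrightarrow> i \<le> n \<Longrightarrow> with_last n H G w i \<in> T i (G i zz)"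
  shows "(zz, w) \<in> extended_solution_set n H T G"
proof -
  have "w i \<in> T i (G i zz)" if "1 \<le> i" "i < n" for i
    using T[of i] that by (simp add: with_last_def)
  moreover have "- D w \<in> T n zz"
    using T[of n] n_ge G_last[OF zz] by (simp add: with_last_def)
  ultimately show ?thesis
    using zz w by (auto simp: extended_solution_set_def prod_space_def)
qed

text \<open>Dual tuples are functions on all indices; this frees component 0 to hold the primal
  variable.\<close>

lemma extended_solution_set_cong:
  assumes "(zz, w) \<in> extended_solution_set n H T G" "\<And>i. 1 \<le> i \<Longrightarrow> i < n \<Longrightarrow> v i = w i"
  shows "(zz, v) \<in> extended_solution_set n H T G"
  using assms dual_sum_cong[of v w]
  by (auto simp: extended_solution_set_def prod_space_def Pi_def)

text \<open>A zero of the Minkowski sum selects \<open>w i\<close> in each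
  \<open>T i (G i zz)\<close> with adjoint images summing to 0. As \<open>G n\<close> is the
  identity on \<open>H 0\<close>, its adjoint fixes \<open>w n\<close>, which is therefore
  \<open>- D w\<close>.\<close>

lemma extended_solution_set_nonempty: "\<exists>zz w. (zz, w) \<in> extended_solution_set n H T G"
proof -
  obtain zz where zz: "zz \<in> H 0" and "0 \<in> (\<Sum>i=1..n. adjoint_on (H 0) (G i) ` T i (G i zz))"
    using problem by (auto simp: splitting_problem_def)
  then obtain s where s0: "(\<Sum>i=1..n. s i) = 0"
    and "\<forall>i\<in>{1..n}. s i \<in> adjoint_on (H 0) (G i) ` T i (G i zz)"
    by (auto simp: set_sum_alt)
  then obtain w where w: "\<And>i. 1 \<le> i \<Longrightarrow> i \<le> n \<Longrightarrow> w i \<in> T i (G i zz) \<and> s i = adjoint_on (H 0) (G i) (w i)"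
    unfolding image_iff by (metis atLeastAtMost_iff)
  have wH: "w i \<in> H i" if "1 \<le> i" "i \<le> n" for i
    using maximal_monotone_op_mem[OF T_maximal[OF that] G_mem[OF that zz]] w[OF that] by blast
  have wn: "w n \<in> H 0" using wH[of n] n_ge H_last by simp
  have "adjoint_on (H 0) (G n) (w n) = w n"
  proof (rule inner_eq_on_imp_eq[OF H_subspace[of 0] adjoint_on_mem[OF H0_hilbert G_linear] wn])
    show "inner u (adjoint_on (H 0) (G n) (w n)) = inner u (w n)" if "u \<in> H 0" for u
      using adjoint_on_inner[OF H0_hilbert G_linear that, of n "w n"] n_ge G_last[OF that] by simp
  qed (use n_ge in auto)
  moreover have "(\<Sum>i=1..n. adjoint_on (H 0) (G i) (w i)) = 0"
    using s0 w by simp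
  ultimately have "- D w = w n"
    using n_ge by (simp add: sum_atLeast1_split_last dual_sum_def neg_eq_iff_add_eq_0)
  then have "with_last n H G w i \<in> T i (G i zz)" if "1 \<le> i" "i \<le> n" for i
    using w[OF that] by (auto simp: with_last_def)
  then show ?thesis using extended_solution_setI[OF zz, of w] wH by auto
qed

text \<open>
  Weak convergence of \<open>x\<^sub>i\<close> and \<open>y\<^sub>i\<close> says nothing about the single products \<open>\<langle>x\<^sub>i, y\<^sub>i\<rangle>\<close>, but the
  vanishing residuals force the sum of these products over \<open>i\<close> to \<open>0\<close>, its value at the weak limit.
\<close>

lemma weak_limit_in_extended_solution_set:
  assumes xH: "\<And>k i. 1 \<le> i \<Longrightarrow> i \<le> n \<Longrightarrow> x k i \<in> H i"
    and yT: "\<And>k i. 1 \<le> i \<Longrightarrow> i \<le> n \<Longrightarrow> y k i \<in> T i (x k i)"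
    and zz: "zz \<in> H 0" and w: "\<And>i. 1 \<le> i \<Longrightarrow> i < n \<Longrightarrow> w i \<in> H i"
    and x: "\<And>i. 1 \<le> i \<Longrightarrow> i \<le> n \<Longrightarrow> weakly_converges_on (H i) (\<lambda>k. x k i) (G i zz)"
    and y: "\<And>i. 1 \<le> i \<Longrightarrow> i \<le> n \<Longrightarrow> weakly_converges_on (H i) (\<lambda>k. y k i) (with_last n H G w i)"
    and bdd: "\<And>i. 1 \<le> i \<Longrightarrow> i \<le> n \<Longrightarrow> bounded (range (\<lambda>k. x k i))"
      "\<And>i. 1 \<le> i \<Longrightarrow> i \<le> n \<Longrightarrow> bounded (range (\<lambda>k. y k i))"
    and primal: "\<And>i. 1 \<le> i \<Longrightarrow> i < n \<Longrightarrow> (\<lambda>k. x k i - G i (x k n)) \<longlonglongrightarrow> 0"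
    and dual: "(\<lambda>k. D (y k) + y k n) \<longlonglongrightarrow> 0"
  shows "(zz, w) \<in> extended_solution_set n H T G"
proof (rule extended_solution_setI[OF zz w])
  let ?v = "with_last n H G w"
  have xn: "x k n \<in> H 0" for k using xH[of n k] n_ge H_last by simp
  have null: "(\<lambda>k. inner (u k) (v k)) \<longlonglongrightarrow> 0"
    if u: "u \<longlonglongrightarrow> 0" and v: "bounded (range v)" for u v :: "nat \<Rightarrow> 'a"
  proof -
    obtain B where B: "\<And>k. norm (v k) \<le> B" using v by (auto simp: bounded_iff)
    show ?thesis
    proof (rule Lim_null_comparison)
      show "\<forall>\<^sub>F k in sequentially. norm (inner (u k) (v k)) \<le> norm (u k) * B"
        using order_trans[OF Cauchy_Schwarz_ineq2 mult_left_mono[OF B norm_ge_zero]] by simp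
      show "(\<lambda>k. norm (u k) * B) \<longlonglongrightarrow> 0"
        using tendsto_mult_left_zero[OF tendsto_norm_zero[OF u]] .
    qed
  qed
  \<comment> \<open>Inserting \<open>G i (x k n)\<close> in the blocks below \<open>n\<close> and
    passing to adjoints leaves only null residuals paired with bounded sequences.\<close>
  have sum_eq: "(\<Sum>i=1..n. inner (x k i) (y k i)) =
      (\<Sum>i=1..<n. inner (x k i - G i (x k n)) (y k i)) + inner (D (y k) + y k n) (x k n)" for k
    using n_ge inner_dual_sum[OF xn, of k "y k"]
    by (simp add: sum_atLeast1_split_last inner_diff inner_add sum_subtractf inner_commute)
  have "(\<lambda>k. \<Sum>i=1..n. inner (x k i) (y k i)) \<longlonglongrightarrow> (\<Sum>i=1..<n. 0) + 0"
    unfolding sum_eq using n_ge by (intro tendsto_add tendsto_sum null primal dual bdd) auto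
  then have lim0: "(\<lambda>k. \<Sum>i=1..n. inner (x k i) (y k i)) \<longlonglongrightarrow> 0" by simp
  have sum0: "(\<Sum>i=1..n. inner (G i zz) (?v i)) = 0"
    using n_ge inner_dual_sum[OF zz, of w] G_last[OF zz]
    by (simp add: sum_atLeast1_split_last with_last_def)
  fix j assume j: "1 \<le> j" "j \<le> n"
  show "?v j \<in> T j (G j zz)"
  proof (rule maximal_monotone_op_family[of "{1..n}" H T "\<lambda>i. G i zz" ?v j])
    fix a b assume ab: "\<And>i. i \<in> {1..n} \<Longrightarrow> a i \<in> H i \<and> b i \<in> T i (a i)"
    have bH: "b i \<in> H i" if "1 \<le> i" "i \<le> n" for i
      using maximal_monotone_op_mem[OF T_maximal[OF that]] ab[of i] that by auto
    \<comment> \<open>After expansion, \<open>lim0\<close> handles the only product of two weakly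
      convergent sequences; the mixed terms have fixed test vectors \<open>a i\<close> and
      \<open>b i\<close>.\<close>
    have "(\<lambda>k. (\<Sum>i=1..n. inner (x k i) (y k i)) - (\<Sum>i=1..n. inner (x k i) (b i))
        - (\<Sum>i=1..n. inner (y k i) (a i)) + (\<Sum>i=1..n. inner (a i) (b i)))
      \<longlonglongrightarrow> 0 - (\<Sum>i=1..n. inner (G i zz) (b i)) - (\<Sum>i=1..n. inner (?v i) (a i))
        + (\<Sum>i=1..n. inner (a i) (b i))"
      using ab bH by (intro tendsto_intros lim0 weakly_converges_on_inner[OF x]
          weakly_converges_on_inner[OF y] H_hilbert) auto
    also have "(\<lambda>k. (\<Sum>i=1..n. inner (x k i) (y k i)) - (\<Sum>i=1..n. inner (x k i) (b i))
        - (\<Sum>i=1..n. inner (y k i) (a i)) + (\<Sum>i=1..n. inner (a i) (b i)))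
      = (\<lambda>k. \<Sum>i=1..n. inner (x k i - a i) (y k i - b i))"
      by (simp add: inner_diff sum_subtractf sum.distrib inner_commute algebra_simps)
    also have "0 - (\<Sum>i=1..n. inner (G i zz) (b i)) - (\<Sum>i=1..n. inner (?v i) (a i))
        + (\<Sum>i=1..n. inner (a i) (b i)) = (\<Sum>i=1..n. inner (G i zz - a i) (?v i - b i))"
      using sum0 by (simp add: inner_diff sum_subtractf sum.distrib inner_commute algebra_simps)
    finally have "(\<lambda>k. \<Sum>i=1..n. inner (x k i - a i) (y k i - b i))
      \<longlonglongrightarrow> (\<Sum>i=1..n. inner (G i zz - a i) (?v i - b i))" .
    moreover have "0 \<le> (\<Sum>i=1..n. inner (x k i - a i) (y k i - b i))" for k
      using ab xH yT by (intro sum_nonneg maximal_monotone_op_mono[OF T_maximal]) auto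
    ultimately show "0 \<le> (\<Sum>i=1..n. inner (G i zz - a i) (?v i - b i))"
      by (intro LIMSEQ_le_const) auto
  qed (use T_maximal G_mem zz with_last_mem w j in auto)
qed

end

subsection \<open>Iterates of the algorithm\<close>

locale inertial_splitting = splitting n H T G
  for n :: nat and H :: "nat \<Rightarrow> 'a::real_inner set" and T G +
  fixes \<gamma> \<alpha>' \<sigma> \<beta>_lo \<beta>_hi \<rho>_lo \<rho>_hi :: real and z :: "int \<Rightarrow> 'a" and w :: "int \<Rightarrow> nat \<Rightarrow> 'a"
    and x y e :: "nat \<Rightarrow> nat \<Rightarrow> 'a" and \<alpha> \<beta> :: "nat \<Rightarrow> real" and \<rho> :: "nat \<Rightarrow> nat \<Rightarrow> real"
  assumes run: "inertial_splitting_run n H T G \<gamma> \<alpha>' \<sigma> \<beta>_lo \<beta>_hi z w x y e \<alpha> \<rho> \<beta>"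
    and \<rho>_lo: "0 < \<rho>_lo"
    and \<rho>_bounds: "\<And>k i. i \<in> {1..n} \<Longrightarrow> \<rho>_lo \<le> \<rho> k i \<and> \<rho> k i \<le> \<rho>_hi"
begin

text \<open>
  Iterates are stored as single families over \<open>{..<n}\<close> whose component \<open>0\<close> is the primal one, and
  the time index of \<open>u\<close> is shifted by one, so that \<open>u 0\<close> is the iterate \<open>-1\<close>.
\<close>

definition c :: "nat \<Rightarrow> real" where "c i = (if i = 0 then \<gamma> else 1)"

definition u :: "nat \<Rightarrow> nat \<Rightarrow> 'a" where
  "u j i = (if i = 0 then z (int j - 1) else w (int j - 1) i)"

text \<open>The extrapolated point of iteration \<open>k\<close>: in the shifted indexing,
  \<open>u (Suc k)\<close> is iterate \<open>k\<close> and \<open>u k\<close> is iterate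
  \<open>k - 1\<close>.\<close>

definition uh :: "nat \<Rightarrow> nat \<Rightarrow> 'a" where
  "uh k i = u (Suc k) i + \<alpha> k *\<^sub>R (u (Suc k) i - u k i)"

text \<open>The gradient of the affine separator for the \<gamma>-inner product;
  \<open>inverse \<gamma>\<close> compensates the weight of component 0.\<close>

definition g :: "nat \<Rightarrow> nat \<Rightarrow> 'a" where
  "g k i = (if i = 0 then inverse \<gamma> *\<^sub>R (D (y k) + y k n) else x k i - G i (x k n))"

text \<open>\<open>uh k\<close> serves both as primal point, through component 0, and as dual tuple;
  the separator reads the tuple only at indices from 1 to \<open>n - 1\<close>.\<close>

definition \<phi> :: "nat \<Rightarrow> real" where
  "\<phi> k = separator n H G (x k) (y k) (uh k 0, uh k)"

definition N :: "nat \<Rightarrow> real" where "N k = (\<Sum>i<n. c i * (norm (g k i))\<^sup>2)"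

lemma parameters:
  shows "0 \<le> \<alpha>'" "\<alpha>' < 1" "0 \<le> \<sigma>" "\<sigma> < 1" "0 < \<beta>_lo" "\<beta>_hi < 2" "0 < \<gamma>"
    and "0 \<le> \<alpha> k" "\<alpha> k \<le> \<alpha>'" "\<beta>_lo \<le> \<beta> k" "\<beta> k \<le> \<beta>_hi"
  using run unfolding inertial_splitting_run_def by blast+

lemma c_pos: "0 < c i"
  using parameters(7) by (simp add: c_def)

lemma extrapolate_z: "extrapolate \<alpha> z k = uh k 0"
  by (simp add: extrapolate_def uh_def u_def)

lemma extrapolate_w: "1 \<le> i \<Longrightarrow> extrapolate \<alpha> (\<lambda>j. w j i) k = uh k i"
  by (simp add: extrapolate_def uh_def u_def)

lemma dual_sum_what: "D (what n H G \<alpha> w k) = D (uh k)"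
  unfolding what_def dual_sum_with_last by (intro dual_sum_cong extrapolate_w)

lemma what_eq: "1 \<le> i \<Longrightarrow> what n H G \<alpha> w k i = with_last n H G (uh k) i"
  using dual_sum_what[of k] unfolding what_def dual_sum_with_last
  by (simp add: with_last_def extrapolate_w)

lemma separator_what: "separator n H G (x k) (y k) (extrapolate \<alpha> z k, what n H G \<alpha> w k) = \<phi> k"
proof -
  have "what n H G \<alpha> w k i = uh k i" if "i \<in> {1..<n}" for i
    using that what_eq[of i k] by (auto simp: with_last_def)
  then show ?thesis
    by (simp add: \<phi>_def separator_def extrapolate_z dual_sum_what)
qed

text \<open>Identifies the squared \<gamma>-norm of the gradient with the denominator of the step
  size; one factor \<open>inverse \<gamma>\<close> cancels the weight.\<close>

lemma N_eq: "N k = inverse \<gamma> * (norm (D (y k) + y k n))\<^sup>2 + (\<Sum>i=1..<n. (norm (x k i - G i (x k n)))\<^sup>2)"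
proof -
  have "\<gamma> * (inverse \<gamma> * norm (D (y k) + y k n))\<^sup>2 = inverse \<gamma> * (norm (D (y k) + y k n))\<^sup>2"
    using parameters(7) by (simp add: power2_eq_square)
  then show ?thesis
    using n_ge parameters(7) unfolding N_def
    by (subst sum_lessThan_split_0) (auto simp: c_def g_def)
qed

lemma block:
  assumes "1 \<le> i" "i \<le> n"
  shows x_mem: "x k i \<in> H i" and y_graph: "y k i \<in> T i (x k i)"
    and block_eq: "\<rho> k i *\<^sub>R y k i + x k i =
      G i (uh k 0) + \<rho> k i *\<^sub>R with_last n H G (uh k) i + e k i"
    and block_err: "(norm (e k i))\<^sup>2 \<le> \<sigma>\<^sup>2 * ((norm (G i (uh k 0) - x k i))\<^sup>2 +
      (norm (\<rho> k i *\<^sub>R (with_last n H G (uh k) i - y k i)))\<^sup>2)"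
proof -
  have "i \<in> {1..n}" using assms by simp
  then have "x k i \<in> H i \<and> y k i \<in> T i (x k i) \<and>
      \<rho> k i *\<^sub>R y k i + x k i = G i (extrapolate \<alpha> z k) + \<rho> k i *\<^sub>R what n H G \<alpha> w k i + e k i \<and>
      (norm (e k i))\<^sup>2 \<le> \<sigma>\<^sup>2 * ((norm (G i (extrapolate \<alpha> z k) - x k i))\<^sup>2 +
         (norm (\<rho> k i *\<^sub>R (what n H G \<alpha> w k i - y k i)))\<^sup>2)"
    using run unfolding inertial_splitting_run_def by blast
  then show "x k i \<in> H i" "y k i \<in> T i (x k i)"
    "\<rho> k i *\<^sub>R y k i + x k i = G i (uh k 0) + \<rho> k i *\<^sub>R with_last n H G (uh k) i + e k i"
    "(norm (e k i))\<^sup>2 \<le> \<sigma>\<^sup>2 * ((norm (G i (uh k 0) - x k i))\<^sup>2 +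
      (norm (\<rho> k i *\<^sub>R (with_last n H G (uh k) i - y k i)))\<^sup>2)"
    using assms by (auto simp: extrapolate_z what_eq)
qed

lemma y_mem: "1 \<le> i \<Longrightarrow> i \<le> n \<Longrightarrow> y k i \<in> H i"
  using maximal_monotone_op_mem[OF T_maximal x_mem y_graph] .

lemma x_last_mem: "x k n \<in> H 0"
  using x_mem[of n k] n_ge H_last by simp

text \<open>A vanishing gradient would make the stopping test succeed, which an infinite run
  excludes.\<close>

lemma N_pos: "0 < N k"
proof -
  have "\<not> ((\<forall>i\<in>{1..<n}. x k i = G i (x k n)) \<and> D (y k) + y k n = 0)"
    using run unfolding inertial_splitting_run_def by blast
  moreover have "0 \<le> N k"
    using c_pos by (auto simp: N_def less_imp_le intro!: sum_nonneg)
  moreover have "(\<forall>i\<in>{1..<n}. x k i = G i (x k n)) \<and> D (y k) + y k n = 0" if "N k = 0"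
  proof -
    have "\<forall>i\<in>{..<n}. c i * (norm (g k i))\<^sup>2 = 0"
      using that c_pos unfolding N_def
      by (subst (asm) sum_nonneg_eq_0_iff) (auto simp: less_imp_le)
    then have "g k i = 0" if "i < n" for i using less_imp_neq[OF c_pos[of i]] that by auto
    from this[of 0] this show ?thesis using n_ge parameters(7) by (fastforce simp: g_def)
  qed
  ultimately show ?thesis by linarith
qed

text \<open>The primal and dual updates become one formula, since \<open>g\<close> carries the
  factor \<open>inverse \<gamma>\<close>. On the left stands iterate \<open>k + 1\<close>.\<close>

lemma u_step:
  assumes "i < n"
  shows "u (Suc (Suc k)) i = uh k i - (\<beta> k * (max 0 (\<phi> k) / N k)) *\<^sub>R g k i"
proof -
  have \<theta>: "step_theta n H G \<gamma> (x k) (y k) (extrapolate \<alpha> z k, what n H G \<alpha> w k) = max 0 (\<phi> k) / N k"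
    unfolding step_theta_def separator_what N_eq ..
  have "z (int k + 1) = uh k 0 - (inverse \<gamma> * \<beta> k * (max 0 (\<phi> k) / N k)) *\<^sub>R (D (y k) + y k n) \<and>
     (\<forall>i\<in>{1..<n}. w (int k + 1) i =
        what n H G \<alpha> w k i - (\<beta> k * (max 0 (\<phi> k) / N k)) *\<^sub>R (x k i - G i (x k n)))"
    using run unfolding inertial_splitting_run_def Let_def \<theta>[symmetric] extrapolate_z[symmetric] by blast
  moreover have "u (Suc (Suc k)) i = (if i = 0 then z (int k + 1) else w (int k + 1) i)"
    by (simp add: u_def add.commute)
  ultimately show ?thesis
    using assms what_eq[of i k] by (auto simp: g_def with_last_def mult_ac)
qed

lemma g_mem: "i < n \<Longrightarrow> g k i \<in> H i"
  using y_mem[of n k] n_ge H_last x_mem[of i k] G_mem[OF _ _ x_last_mem, of i]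
  by (auto simp: g_def intro!: subspace_scale subspace_add subspace_diff H_subspace dual_sum_mem)

lemma uh_memI: "i < n \<Longrightarrow> u k i \<in> H i \<Longrightarrow> u (Suc k) i \<in> H i \<Longrightarrow> uh k i \<in> H i"
  unfolding uh_def by (intro subspace_add subspace_scale subspace_diff H_subspace) auto

lemma u_mem:
  assumes i: "i < n"
  shows "u k i \<in> H i"
\<comment> \<open>Extrapolation looks back two iterates, hence the two-step induction.\<close>
proof (induction k rule: induct_nat_012)
  have start: "(z 0, w 0) \<in> prod_space n H" "z (- 1) = z 0" "\<forall>i\<in>{1..<n}. w (- 1) i = w 0 i"
    using run unfolding inertial_splitting_run_def by blast+
  show "u 0 i \<in> H i" "u (Suc 0) i \<in> H i"
    using start i by (auto simp: u_def prod_space_def)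
  show "u (Suc (Suc k)) i \<in> H i" if "u k i \<in> H i" "u (Suc k) i \<in> H i" for k
    unfolding u_step[OF i]
    by (intro subspace_diff subspace_scale uh_memI H_subspace g_mem i that) (use i in auto)
qed

lemma uh_mem: "i < n \<Longrightarrow> uh k i \<in> H i"
  by (intro uh_memI u_mem)

lemma uh_0_mem: "uh k 0 \<in> H 0"
  using uh_mem[of 0 k] n_ge by simp

lemma separator_eq_gradient:
  assumes "s 0 \<in> H 0"
  shows "separator n H G (x k) (y k) (s 0, s) =
    (\<Sum>i<n. c i * inner (s i) (g k i)) - (\<Sum>i=1..n. inner (x k i) (y k i))"
proof -
  have "(\<Sum>i<n. c i * inner (s i) (g k i)) =
      inner (s 0) (D (y k) + y k n) + (\<Sum>i=1..<n. inner (s i) (x k i - G i (x k n)))"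
    using n_ge parameters(7) by (subst sum_lessThan_split_0) (auto simp: c_def g_def)
  then show ?thesis
    using separator_affine[where x = "x k" and y = "y k" and zz = "s 0" and w = s, OF assms x_last_mem]
    by simp
qed

section \<open>Decrease of the distance to a solution\<close>

text \<open>The separator is nonpositive at the solution \<open>s\<close>, so
  \<open>\<phi> k\<close> is at most its difference to that value, where the affine constants cancel
  and the gradient paired with \<open>uh k - s\<close> remains.\<close>

lemma fejer_step:
  assumes s: "(s 0, s) \<in> extended_solution_set n H T G"
  shows "(\<Sum>i<n. c i * (norm (u (Suc (Suc k)) i - s i))\<^sup>2) + \<beta>_lo * (2 - \<beta>_hi) * ((max 0 (\<phi> k))\<^sup>2 / N k)
    \<le> (\<Sum>i<n. c i * (norm (uh k i - s i))\<^sup>2)"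
proof -
  have s0: "s 0 \<in> H 0" using s by (simp add: extended_solution_set_def prod_space_def)
  have "\<phi> k \<le> \<phi> k - separator n H G (x k) (y k) (s 0, s)"
    using separator_nonpos[OF s, of "x k" "y k"] x_mem y_graph by simp
  also have "\<dots> = (\<Sum>i<n. c i * inner (uh k i - s i) (g k i))"
    unfolding \<phi>_def separator_eq_gradient[where s = s, OF s0]
      separator_eq_gradient[where s = "uh k", OF uh_0_mem]
    by (simp add: inner_diff_left right_diff_distrib sum_subtractf)
  finally have "(\<Sum>i<n. c i * (norm (u (Suc (Suc k)) i - s i))\<^sup>2) + \<beta> k * (2 - \<beta> k) * ((max 0 (\<phi> k))\<^sup>2 / N k)
    \<le> (\<Sum>i<n. c i * (norm (uh k i - s i))\<^sup>2)"
    using relaxed_projection_step[of "N k" c "g k" "{..<n}" "\<beta> k" "\<phi> k" "uh k" s] N_pos[of k]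
      parameters(5) parameters(10)[of k]
    by (simp add: N_def u_step)
  moreover have "\<beta>_lo * (2 - \<beta>_hi) * ((max 0 (\<phi> k))\<^sup>2 / N k) \<le> \<beta> k * (2 - \<beta> k) * ((max 0 (\<phi> k))\<^sup>2 / N k)"
    using parameters(5,6) parameters(10,11)[of k] N_pos[of k]
    by (intro mult_right_mono mult_mono) auto
  ultimately show ?thesis by linarith
qed

lemma inertial_fejer_step:
  assumes s: "(s 0, s) \<in> extended_solution_set n H T G"
  defines "h \<equiv> \<lambda>j. \<Sum>i<n. c i * (norm (u j i - s i))\<^sup>2"
  shows "h (Suc (Suc k)) - h (Suc k) + \<beta>_lo * (2 - \<beta>_hi) * ((max 0 (\<phi> k))\<^sup>2 / N k) \<le>
    \<alpha> k * (h (Suc k) - h k) + 2 * (\<alpha> k * (\<Sum>i<n. c i * (norm (u (Suc k) i - u k i))\<^sup>2))"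
proof -
  define d where "d = (\<Sum>i<n. c i * (norm (u (Suc k) i - u k i))\<^sup>2)"
  have d0: "0 \<le> d" unfolding d_def using c_pos by (intro sum_nonneg) (auto simp: less_imp_le)
  have "(\<Sum>i<n. c i * (norm (uh k i - s i))\<^sup>2) = (\<Sum>i<n. (1 + \<alpha> k) * (c i * (norm (u (Suc k) i - s i))\<^sup>2)
     - \<alpha> k * (c i * (norm (u k i - s i))\<^sup>2) + \<alpha> k * (1 + \<alpha> k) * (c i * (norm (u (Suc k) i - u k i))\<^sup>2))"
    unfolding uh_def norm_extrapolate by (intro sum.cong refl) (simp add: algebra_simps)
  also have "\<dots> = (1 + \<alpha> k) * h (Suc k) - \<alpha> k * h k + \<alpha> k * (1 + \<alpha> k) * d"
    by (simp add: h_def d_def sum.distrib sum_subtractf sum_distrib_left)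
  \<comment> \<open>From \<open>\<alpha> k \<le> 1\<close> the factor
    \<open>\<alpha> k * (1 + \<alpha> k)\<close> is at most \<open>2 * \<alpha> k\<close>, which
    makes the error a multiple of the summable term.\<close>
  also have "\<dots> \<le> (1 + \<alpha> k) * h (Suc k) - \<alpha> k * h k + 2 * (\<alpha> k * d)"
    using mult_right_mono[of "\<alpha> k" 1 "\<alpha> k * d"] parameters(2) parameters(8,9)[of k] d0
    by (simp add: algebra_simps)
  finally show ?thesis
    using fejer_step[OF s, of k] unfolding d_def[symmetric] h_def[symmetric]
    by (simp add: algebra_simps h_def)
qed

section \<open>Residual bounds for the separator and its gradient\<close>

definition R :: "nat \<Rightarrow> real" where
  "R k = (\<Sum>i=1..n. (norm (G i (uh k 0) - x k i))\<^sup>2 + (norm (y k i - with_last n H G (uh k) i))\<^sup>2)"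

lemma R_nonneg: "0 \<le> R k"
  unfolding R_def by (intro sum_nonneg) auto

lemma residual_le_R:
  assumes "1 \<le> i" "i \<le> n"
  shows "norm (G i (uh k 0) - x k i) \<le> sqrt (R k)"
    and "norm (y k i - with_last n H G (uh k) i) \<le> sqrt (R k)"
proof -
  have "(norm (G i (uh k 0) - x k i))\<^sup>2 + (norm (y k i - with_last n H G (uh k) i))\<^sup>2 \<le> R k"
    unfolding R_def using assms by (intro member_le_sum) auto
  then show "norm (G i (uh k 0) - x k i) \<le> sqrt (R k)"
    "norm (y k i - with_last n H G (uh k) i) \<le> sqrt (R k)"
    by (auto intro!: real_le_rsqrt intro: order_trans[rotated])
qed

lemma separator_lower_bound:
  obtains \<kappa> where "0 < \<kappa>" "\<And>k. \<kappa> * R k \<le> \<phi> k"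
proof -
  define \<kappa> where "\<kappa> = (1 - \<sigma>\<^sup>2) / 2 * min (1 / \<rho>_hi) \<rho>_lo"
  \<comment> \<open>Positivity is read off from block 1 of iteration 0, which exists because
    \<open>n\<close> is at least 2.\<close>
  have "0 < \<rho>_hi" using \<rho>_lo \<rho>_bounds[of 1 0] n_ge by auto
  moreover have "\<sigma>\<^sup>2 < 1" using parameters(3,4) by (simp add: power_less_one_iff)
  ultimately have "0 < \<kappa>" using \<rho>_lo by (auto simp: \<kappa>_def)
  moreover have "\<kappa> * R k \<le> \<phi> k" for k
    unfolding R_def \<phi>_def separator_eq_sum[OF uh_0_mem] sum_distrib_left \<kappa>_def
  proof (rule sum_mono)
    fix i assume i: "i \<in> {1..n}"
    have e: "e k i = \<rho> k i *\<^sub>R (y k i - with_last n H G (uh k) i) - (G i (uh k 0) - x k i)"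
      using block_eq[of i k] i by (simp add: algebra_simps)
    show "(1 - \<sigma>\<^sup>2) / 2 * min (1 / \<rho>_hi) \<rho>_lo *
        ((norm (G i (uh k 0) - x k i))\<^sup>2 + (norm (y k i - with_last n H G (uh k) i))\<^sup>2)
      \<le> inner (G i (uh k 0) - x k i) (y k i - with_last n H G (uh k) i)"
      using block_err[of i k] i parameters(3,4) \<rho>_bounds[OF i, of k]
      by (intro error_criterion_bound[OF \<rho>_lo _ _ _ _ e])
        (auto simp: norm_minus_commute)
  qed
  ultimately show thesis by (rule that)
qed

text \<open>Both gradient parts are combinations of residuals: replacing each \<open>y k i\<close>
  by its residual leaves \<open>D (y k) + y k n\<close> unchanged, and
  \<open>x k i - G i (x k n)\<close> is \<open>G i\<close> of the last residual minus the
  \<open>i\<close>-th one. The constant \<open>1 + real n * K\<close> covers both.\<close>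

lemma gradient_bound:
  "\<exists>C>0. \<forall>k. norm (D (y k) + y k n) \<le> C * sqrt (R k) \<and>
    (\<forall>i\<in>{1..<n}. norm (x k i - G i (x k n)) \<le> C * sqrt (R k))"
proof -
  obtain K where K: "1 \<le> K"
    "\<And>i u. 1 \<le> i \<Longrightarrow> i \<le> n \<Longrightarrow> u \<in> H 0 \<Longrightarrow> norm (G i u) \<le> K * norm u"
    "\<And>i v. 1 \<le> i \<Longrightarrow> i \<le> n \<Longrightarrow> norm (adjoint_on (H 0) (G i) v) \<le> K * norm v"
    using G_bound by metis
  have sq: "0 \<le> sqrt (R k)" for k using R_nonneg by simp
  have Kn: "K \<le> real n * K" using K(1) n_ge mult_right_mono[of 1 "real n" K] by simp
  have dual: "norm (D (y k) + y k n) \<le> (1 + real n * K) * sqrt (R k)" for k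
  proof -
    let ?b = "\<lambda>i. y k i - with_last n H G (uh k) i"
    have "D (y k) + y k n = D ?b + ?b n"
      unfolding dual_sum_diff dual_sum_with_last by (simp add: with_last_def)
    then have "norm (D (y k) + y k n) \<le> norm (D ?b) + norm (?b n)"
      by (simp only: norm_triangle_ineq)
    moreover have "norm (D ?b) \<le> (\<Sum>i=1..<n. K * sqrt (R k))"
      unfolding dual_sum_def
    proof (rule order_trans[OF norm_sum sum_mono])
      fix i assume i: "i \<in> {1..<n}"
      then show "norm (adjoint_on (H 0) (G i) (?b i)) \<le> K * sqrt (R k)"
        using K(1) by (intro order_trans[OF K(3) mult_left_mono[OF residual_le_R(2)]]) auto
    qed
    moreover have "(\<Sum>i=1..<n. K * sqrt (R k)) \<le> real n * (K * sqrt (R k))"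
      using K(1) sq[of k] by (simp add: mult_right_mono)
    moreover have "norm (?b n) \<le> sqrt (R k)"
      using n_ge by (intro residual_le_R(2)) auto
    moreover have "(1 + real n * K) * sqrt (R k) = sqrt (R k) + real n * (K * sqrt (R k))"
      by (simp add: algebra_simps)
    ultimately show ?thesis by linarith
  qed
  have primal: "norm (x k i - G i (x k n)) \<le> (1 + real n * K) * sqrt (R k)" if i: "1 \<le> i" "i < n" for k i
  proof -
    have d: "uh k 0 - x k n \<in> H 0"
      by (intro subspace_diff H_subspace uh_0_mem x_last_mem) auto
    have "x k i - G i (x k n) = G i (uh k 0 - x k n) - (G i (uh k 0) - x k i)"
      using bounded_linear_on_diff[OF G_linear H_subspace uh_0_mem x_last_mem, of i] i by simp
    moreover have "norm (G i (uh k 0 - x k n)) \<le> K * sqrt (R k)"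
      using K(1) residual_le_R(1)[of n k] n_ge i G_last[OF uh_0_mem]
      by (intro order_trans[OF K(2)[OF _ _ d] mult_left_mono]) auto
    moreover have "norm (G i (uh k 0) - x k i) \<le> sqrt (R k)"
      using i by (intro residual_le_R) auto
    moreover have "K * sqrt (R k) \<le> real n * K * sqrt (R k)"
      by (rule mult_right_mono[OF Kn sq])
    ultimately show ?thesis
      using norm_triangle_ineq4[of "G i (uh k 0 - x k n)" "G i (uh k 0) - x k i"]
      by (simp add: algebra_simps)
  qed
  show ?thesis
    using K(1) dual primal by (intro exI[of _ "1 + real n * K"]) (auto intro: add_pos_nonneg)
qed

text \<open>From \<open>\<kappa> * R k \<le> \<phi> k\<close> and \<open>N k \<le> B * R k\<close>,
  the quotient is at least \<open>\<kappa>\<^sup>2 / B\<close> times \<open>R k\<close>.\<close>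

lemma R_le_separator:
  obtains M where "0 < M" "\<And>k. R k \<le> M * ((max 0 (\<phi> k))\<^sup>2 / N k)"
proof -
  obtain \<kappa> where \<kappa>: "0 < \<kappa>" "\<And>k. \<kappa> * R k \<le> \<phi> k" using separator_lower_bound by blast
  obtain C where C: "0 < C" "\<And>k. norm (D (y k) + y k n) \<le> C * sqrt (R k)"
    "\<And>k i. 1 \<le> i \<Longrightarrow> i < n \<Longrightarrow> norm (x k i - G i (x k n)) \<le> C * sqrt (R k)"
    using gradient_bound by auto
  define B where "B = inverse \<gamma> * C\<^sup>2 + real n * C\<^sup>2"
  have B: "0 < B" using C(1) parameters(7) by (auto simp: B_def intro!: add_pos_nonneg)
  have sq: "a\<^sup>2 \<le> C\<^sup>2 * R k" if "a \<le> C * sqrt (R k)" "0 \<le> a" for a k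
    using power_mono[OF that, of 2] R_nonneg by (simp add: power_mult_distrib)
  have NB: "N k \<le> B * R k" for k
  proof -
    have "(\<Sum>i=1..<n. (norm (x k i - G i (x k n)))\<^sup>2) \<le> (\<Sum>i=1..<n. C\<^sup>2 * R k)"
      using C(3) by (intro sum_mono sq) auto
    also have "\<dots> \<le> real n * (C\<^sup>2 * R k)"
      using R_nonneg[of k] by (simp add: mult_right_mono)
    finally show ?thesis
      using mult_left_mono[OF sq[OF C(2)[of k] norm_ge_zero], of "inverse \<gamma>"] parameters(7)
      unfolding N_eq B_def distrib_right mult.assoc by (intro add_mono) auto
  qed
  have "R k \<le> B / \<kappa>\<^sup>2 * ((max 0 (\<phi> k))\<^sup>2 / N k)" for k
  proof -
    \<comment> \<open>Positivity of \<open>N k\<close> forces \<open>R k > 0\<close>, so the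
      division by \<open>B * R k\<close> is legitimate.\<close>
    have "0 < B * R k" using N_pos NB by (rule order_less_le_trans)
    then have R: "0 < R k" using B by (simp add: zero_less_mult_iff)
    have "(\<kappa> * R k)\<^sup>2 \<le> (max 0 (\<phi> k))\<^sup>2"
      using \<kappa>(1) \<kappa>(2)[of k] R by (intro power_mono) auto
    then have "(\<kappa> * R k)\<^sup>2 / (B * R k) \<le> (max 0 (\<phi> k))\<^sup>2 / N k"
      using N_pos[of k] NB[of k] by (intro frac_le) auto
    then have "B / \<kappa>\<^sup>2 * ((\<kappa> * R k)\<^sup>2 / (B * R k)) \<le> B / \<kappa>\<^sup>2 * ((max 0 (\<phi> k))\<^sup>2 / N k)"
      using B by (intro mult_left_mono) auto
    moreover have "B / \<kappa>\<^sup>2 * ((\<kappa> * R k)\<^sup>2 / (B * R k)) = R k"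
      using B R \<kappa>(1) by (simp add: power2_eq_square)
    ultimately show ?thesis by simp
  qed
  moreover have "0 < B / \<kappa>\<^sup>2" using B \<kappa>(1) by simp
  ultimately show thesis using that by blast
qed

end

subsection \<open>Weak convergence of the iterates\<close>

lemma bounded_range_add_null:
  fixes X Y :: "nat \<Rightarrow> 'a::real_normed_vector"
  assumes "bounded (range X)" "(\<lambda>k. Y k - X k) \<longlonglongrightarrow> 0"
  shows "bounded (range Y)"
proof -
  have "bounded (range (\<lambda>k. X k + (Y k - X k)))"
    using assms(1) convergent_imp_bounded[OF assms(2)] by (rule bounded_plus_comp)
  then show ?thesis by simp
qed

context inertial_splitting
begin

context
  assumes summable: "summable (\<lambda>k. \<alpha> k * (\<Sum>i<n. c i * (norm (u (Suc k) i - u k i))\<^sup>2))"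
begin

lemma distance_convergent:
  assumes s: "(s 0, s) \<in> extended_solution_set n H T G"
  shows "convergent (\<lambda>k. \<Sum>i<n. c i * (norm (u k i - s i))\<^sup>2)"
    and "summable (\<lambda>k. \<beta>_lo * (2 - \<beta>_hi) * ((max 0 (\<phi> k))\<^sup>2 / N k))"
proof -
  let ?h = "\<lambda>j. \<Sum>i<n. c i * (norm (u j i - s i))\<^sup>2"
  let ?\<delta> = "\<lambda>k. 2 * (\<alpha> k * (\<Sum>i<n. c i * (norm (u (Suc k) i - u k i))\<^sup>2))"
  have c0: "0 \<le> c i" for i using c_pos[of i] by simp
  have h: "0 \<le> ?h k" for k by (intro sum_nonneg mult_nonneg_nonneg c0 zero_le_power2)
  have "0 \<le> (\<Sum>i<n. c i * (norm (u (Suc k) i - u k i))\<^sup>2)" for k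
    by (intro sum_nonneg mult_nonneg_nonneg c0 zero_le_power2)
  then have \<delta>: "0 \<le> ?\<delta> k" for k using parameters(8)[of k] by simp
  have Q: "0 \<le> \<beta>_lo * (2 - \<beta>_hi) * ((max 0 (\<phi> k))\<^sup>2 / N k)" for k
    using parameters(5,6) N_pos[of k] by simp
  note fejer = h Q \<delta> summable_mult[OF summable] parameters(8,9,2) inertial_fejer_step[OF s]
  note limits = inertial_quasi_fejer[where h = ?h and \<delta> = ?\<delta> and \<alpha> = \<alpha> and a = \<alpha>'
      and Q = "\<lambda>k. \<beta>_lo * (2 - \<beta>_hi) * ((max 0 (\<phi> k))\<^sup>2 / N k)", OF fejer]
  show "convergent ?h" by (rule limits(1))
  show "summable (\<lambda>k. \<beta>_lo * (2 - \<beta>_hi) * ((max 0 (\<phi> k))\<^sup>2 / N k))"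
    by (rule limits(2))
qed

text \<open>Overwriting component 0 of the dual tuple by the primal point encodes a solution as one
  family, matching the layout of \<open>u\<close>.\<close>

lemma solution_family: obtains s where "(s 0, s) \<in> extended_solution_set n H T G"
proof -
  obtain zz v where "(zz, v) \<in> extended_solution_set n H T G"
    using extended_solution_set_nonempty by blast
  then have "(zz, v(0 := zz)) \<in> extended_solution_set n H T G"
    by (rule extended_solution_set_cong) simp
  then show thesis using that[of "v(0 := zz)"] by simp
qed

lemma R_null: "R \<longlonglongrightarrow> 0"
proof -
  obtain s where s: "(s 0, s) \<in> extended_solution_set n H T G" by (rule solution_family)
  obtain M where M: "\<And>k. R k \<le> M * ((max 0 (\<phi> k))\<^sup>2 / N k)" using R_le_separator by blast
  define b where "b = \<beta>_lo * (2 - \<beta>_hi)"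
  have "0 < b" using parameters(5,6) by (simp add: b_def)
  have "(\<lambda>k. M / b * (b * ((max 0 (\<phi> k))\<^sup>2 / N k))) \<longlonglongrightarrow> M / b * 0"
    by (intro tendsto_intros summable_LIMSEQ_zero distance_convergent(2)[OF s, folded b_def])
  also have "(\<lambda>k. M / b * (b * ((max 0 (\<phi> k))\<^sup>2 / N k))) = (\<lambda>k. M * ((max 0 (\<phi> k))\<^sup>2 / N k))"
    using \<open>0 < b\<close> by simp
  finally have "(\<lambda>k. M * ((max 0 (\<phi> k))\<^sup>2 / N k)) \<longlonglongrightarrow> 0" by simp
  then show ?thesis
    by (rule tendsto_sandwich[OF _ _ tendsto_const, rotated 2]) (intro always_eventually allI R_nonneg M)+
qed

lemma norm_le_sqrt_R_null:
  assumes "\<And>k. norm (X k) \<le> C * sqrt (R k)"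
  shows "X \<longlonglongrightarrow> 0"
proof (rule Lim_null_comparison)
  show "\<forall>\<^sub>F k in sequentially. norm (X k) \<le> C * sqrt (R k)" using assms by simp
  show "(\<lambda>k. C * sqrt (R k)) \<longlonglongrightarrow> 0"
    using tendsto_mult_right_zero[of "\<lambda>k. sqrt (R k)"] tendsto_real_sqrt[OF R_null] by simp
qed

lemma residuals_null:
  assumes "1 \<le> i" "i \<le> n"
  shows "(\<lambda>k. x k i - G i (uh k 0)) \<longlonglongrightarrow> 0"
    and "(\<lambda>k. y k i - with_last n H G (uh k) i) \<longlonglongrightarrow> 0"
proof -
  show "(\<lambda>k. x k i - G i (uh k 0)) \<longlonglongrightarrow> 0"
    by (rule norm_le_sqrt_R_null[where C = 1])
      (use residual_le_R(1)[OF assms] in \<open>simp add: norm_minus_commute\<close>)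
  show "(\<lambda>k. y k i - with_last n H G (uh k) i) \<longlonglongrightarrow> 0"
    by (rule norm_le_sqrt_R_null[where C = 1]) (use residual_le_R(2)[OF assms] in simp)
qed

lemma gradient_null:
  shows "(\<lambda>k. D (y k) + y k n) \<longlonglongrightarrow> 0"
    and "1 \<le> i \<Longrightarrow> i < n \<Longrightarrow> (\<lambda>k. x k i - G i (x k n)) \<longlonglongrightarrow> 0"
proof -
  obtain C where C: "0 < C" "\<And>k. norm (D (y k) + y k n) \<le> C * sqrt (R k)"
    "\<And>k i. 1 \<le> i \<Longrightarrow> i < n \<Longrightarrow> norm (x k i - G i (x k n)) \<le> C * sqrt (R k)"
    using gradient_bound by auto
  show "(\<lambda>k. D (y k) + y k n) \<longlonglongrightarrow> 0"
    by (rule norm_le_sqrt_R_null) (rule C(2))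
  show "(\<lambda>k. x k i - G i (x k n)) \<longlonglongrightarrow> 0" if "1 \<le> i" "i < n"
    by (rule norm_le_sqrt_R_null) (rule C(3)[OF that])
qed

text \<open>The displacement is \<open>\<alpha> k\<close> times a difference of iterates;
  \<open>(\<alpha> k)\<^sup>2 \<le> \<alpha> k\<close> bounds its square by a multiple of the terms
  of the summable series.\<close>

lemma extrapolation_null:
  assumes i: "i < n"
  shows "(\<lambda>k. uh k i - u (Suc k) i) \<longlonglongrightarrow> 0"
proof -
  let ?d = "\<lambda>k. \<alpha> k * (\<Sum>i<n. c i * (norm (u (Suc k) i - u k i))\<^sup>2)"
  have d: "(\<lambda>k. inverse (c i) * ?d k) \<longlonglongrightarrow> 0"
    using tendsto_mult_right_zero[OF summable_LIMSEQ_zero[OF summable]] .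
  have "(norm (uh k i - u (Suc k) i))\<^sup>2 \<le> inverse (c i) * ?d k" for k
  proof -
    have "c i * (norm (u (Suc k) i - u k i))\<^sup>2 \<le> (\<Sum>i<n. c i * (norm (u (Suc k) i - u k i))\<^sup>2)"
      using c_pos i by (intro member_le_sum) (auto simp: less_imp_le)
    then have "\<alpha> k * (c i * (norm (u (Suc k) i - u k i))\<^sup>2) \<le> ?d k"
      by (rule mult_left_mono[OF _ parameters(8)])
    then have "\<alpha> k * (norm (u (Suc k) i - u k i))\<^sup>2 \<le> inverse (c i) * ?d k"
      using c_pos[of i] by (simp add: field_simps)
    moreover have "(norm (uh k i - u (Suc k) i))\<^sup>2 \<le> \<alpha> k * (norm (u (Suc k) i - u k i))\<^sup>2"
    proof -
      have "(\<alpha> k)\<^sup>2 \<le> \<alpha> k"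
        using parameters(2) parameters(8,9)[of k] mult_left_mono[of "\<alpha> k" 1 "\<alpha> k"]
        by (simp add: power2_eq_square)
      moreover have "(norm (uh k i - u (Suc k) i))\<^sup>2 = (\<alpha> k)\<^sup>2 * (norm (u (Suc k) i - u k i))\<^sup>2"
        by (simp add: uh_def power_mult_distrib)
      ultimately show ?thesis by (simp only: mult_right_mono zero_le_power2)
    qed
    ultimately show ?thesis by linarith
  qed
  then have "(\<lambda>k. (norm (uh k i - u (Suc k) i))\<^sup>2) \<longlonglongrightarrow> 0"
    by (intro tendsto_sandwich[OF _ _ tendsto_const d] always_eventually allI zero_le_power2)
  then have "(\<lambda>k. norm (uh k i - u (Suc k) i)) \<longlonglongrightarrow> 0"
    using tendsto_real_sqrt[of "\<lambda>k. (norm (uh k i - u (Suc k) i))\<^sup>2" 0 sequentially] by simp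
  then show ?thesis by (rule tendsto_norm_zero_cancel)
qed

lemma sequences_bounded:
  assumes i: "1 \<le> i" "i \<le> n"
  shows x_bounded: "bounded (range (\<lambda>k. x k i))"
    and y_bounded: "bounded (range (\<lambda>k. y k i))"
proof -
  obtain s where s: "(s 0, s) \<in> extended_solution_set n H T G" by (rule solution_family)
  have uh: "bounded (range (\<lambda>k. uh k i))" if i: "i < n" for i
  proof (rule bounded_range_add_null[OF _ extrapolation_null[OF i]])
    have "bounded (range (\<lambda>k. u k i))"
      using bounded_if_weighted_distance_convergent[of "{..<n}" c u s i] distance_convergent(1)[OF s]
        c_pos i by auto
    then show "bounded (range (\<lambda>k. u (Suc k) i))" by (rule bounded_subset) auto
  qed
  obtain K where K: "1 \<le> K"
    "\<And>i u. 1 \<le> i \<Longrightarrow> i \<le> n \<Longrightarrow> u \<in> H 0 \<Longrightarrow> norm (G i u) \<le> K * norm u"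
    "\<And>i v. 1 \<le> i \<Longrightarrow> i \<le> n \<Longrightarrow> norm (adjoint_on (H 0) (G i) v) \<le> K * norm v"
    using G_bound by metis
  have "\<exists>b. \<forall>k. norm (uh k i) \<le> b" if "i < n" for i
    using uh[OF that] by (auto simp: bounded_iff)
  then obtain b where b: "\<And>i k. i < n \<Longrightarrow> norm (uh k i) \<le> b i" by metis
  have "norm (G i (uh k 0)) \<le> K * b 0" for k
    using K(1) n_ge by (intro order_trans[OF K(2)[OF i uh_0_mem] mult_left_mono[OF b]]) auto
  then have "bounded (range (\<lambda>k. G i (uh k 0)))" by (auto simp: bounded_iff)
  then show "bounded (range (\<lambda>k. x k i))" using residuals_null(1)[OF i] by (rule bounded_range_add_null)
  have "norm (D (uh k)) \<le> (\<Sum>i=1..<n. K * b i)" for k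
    unfolding dual_sum_def
  proof (rule order_trans[OF norm_sum sum_mono])
    show "norm (adjoint_on (H 0) (G i) (uh k i)) \<le> K * b i" if "i \<in> {1..<n}" for i
      using that K(1) by (intro order_trans[OF K(3) mult_left_mono[OF b]]) auto
  qed
  then have "norm (with_last n H G (uh k) i) \<le> (if i = n then (\<Sum>i=1..<n. K * b i) else b i)" for k
    using b[of i k] i by (auto simp: with_last_def)
  then have "bounded (range (\<lambda>k. with_last n H G (uh k) i))" by (auto simp: bounded_iff)
  then show "bounded (range (\<lambda>k. y k i))" using residuals_null(2)[OF i] by (rule bounded_range_add_null)
qed

text \<open>Serves twice: with an arbitrary subsequence to identify cluster points, and with the
  identity to obtain the limits of the full sequences \<open>x\<close> and \<open>y\<close>.\<close>

lemma weak_limits_along_subseq: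
  assumes r: "strict_mono r"
    and l: "\<And>i. i < n \<Longrightarrow> weakly_converges_on (H i) (\<lambda>k. u (Suc (r k)) i) (l i)"
    and i: "1 \<le> i" "i \<le> n"
  shows "weakly_converges_on (H i) (\<lambda>k. x (r k) i) (G i (l 0))"
    and "weakly_converges_on (H i) (\<lambda>k. y (r k) i) (with_last n H G l i)"
proof -
  note sub = LIMSEQ_subseq_LIMSEQ[OF _ r, unfolded o_def]
  have uh: "weakly_converges_on (H i) (\<lambda>k. uh (r k) i) (l i)" if "i < n" for i
    by (rule weakly_converges_on_add_null[OF H_hilbert l uh_mem sub[OF extrapolation_null]])
      (use that in auto)
  have "weakly_converges_on (H i) (\<lambda>k. G i (uh (r k) 0)) (G i (l 0))"
    using n_ge i by (intro weakly_converges_on_image[OF H0_hilbert H_hilbert G_linear uh]) auto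
  then show "weakly_converges_on (H i) (\<lambda>k. x (r k) i) (G i (l 0))"
    using i by (intro weakly_converges_on_add_null[OF H_hilbert _ x_mem sub[OF residuals_null(1)]]) auto
  have "weakly_converges_on (H 0) (\<lambda>k. - D (uh (r k))) (- D l)"
    unfolding dual_sum_def
    by (intro weakly_converges_on_uminus H0_hilbert weakly_converges_on_sum
        weakly_converges_on_adjoint[OF H0_hilbert H_hilbert G_linear uh]) auto
  then have "weakly_converges_on (H i) (\<lambda>k. with_last n H G (uh (r k)) i) (with_last n H G l i)"
    using uh[of i] i H_last by (auto simp: with_last_def)
  then show "weakly_converges_on (H i) (\<lambda>k. y (r k) i) (with_last n H G l i)"
    using i by (intro weakly_converges_on_add_null[OF H_hilbert _ y_mem sub[OF residuals_null(2)]]) auto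
qed

lemma weak_cluster_point_solution:
  assumes r: "strict_mono r"
    and l: "\<And>i. i < n \<Longrightarrow> weakly_converges_on (H i) (\<lambda>k. u (Suc (r k)) i) (l i)"
  shows "(l 0, l) \<in> extended_solution_set n H T G"
proof -
  have lH: "l i \<in> H i" if "i < n" for i
    using weakly_converges_on_limit_mem[OF l[OF that]] .
  note sub = LIMSEQ_subseq_LIMSEQ[OF _ r, unfolded o_def]
  show ?thesis
  proof (rule weak_limit_in_extended_solution_set[where x = "\<lambda>k. x (r k)" and y = "\<lambda>k. y (r k)"])
    show "l 0 \<in> H 0" "\<And>i. 1 \<le> i \<Longrightarrow> i < n \<Longrightarrow> l i \<in> H i"
      using lH n_ge by auto
    show "(\<lambda>k. D (y (r k)) + y (r k) n) \<longlonglongrightarrow> 0"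
      by (rule sub[OF gradient_null(1)])
    show "(\<lambda>k. x (r k) i - G i (x (r k) n)) \<longlonglongrightarrow> 0" if "1 \<le> i" "i < n" for i
      by (rule sub[OF gradient_null(2)[OF that]])
    fix i assume i: "1 \<le> i" "i \<le> n"
    show "x (r k) i \<in> H i" "y (r k) i \<in> T i (x (r k) i)" for k
      by (rule x_mem[OF i] y_graph[OF i])+
    show "bounded (range (\<lambda>k. x (r k) i))" by (rule bounded_subset[OF x_bounded[OF i]]) auto
    show "bounded (range (\<lambda>k. y (r k) i))" by (rule bounded_subset[OF y_bounded[OF i]]) auto
    show "weakly_converges_on (H i) (\<lambda>k. x (r k) i) (G i (l 0))"
      by (rule weak_limits_along_subseq(1)[OF r l i])
    show "weakly_converges_on (H i) (\<lambda>k. y (r k) i) (with_last n H G l i)"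
      by (rule weak_limits_along_subseq(2)[OF r l i])
  qed
qed

lemma weak_convergence:
  "\<exists>l. (l 0, l) \<in> extended_solution_set n H T G \<and>
     (\<forall>i<n. weakly_converges_on (H i) (\<lambda>k. u (Suc k) i) (l i)) \<and>
     (\<forall>i\<in>{1..n}. weakly_converges_on (H i) (\<lambda>k. x k i) (G i (l 0)) \<and>
       weakly_converges_on (H i) (\<lambda>k. y k i) (with_last n H G l i))"
proof -
  let ?S = "{s. (s 0, s) \<in> extended_solution_set n H T G}"
  have "\<exists>l\<in>?S. \<forall>i\<in>{..<n}. weakly_converges_on (H i) (\<lambda>k. u (Suc k) i) (l i)"
  \<comment> \<open>The shift by \<open>Suc\<close> discards iterate \<open>-1\<close>, so the
    family at \<open>k\<close> is iterate \<open>k\<close> of the algorithm.\<close>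
  proof (rule opial_family[of "{..<n}" c H "\<lambda>k. u (Suc k)" ?S])
    show "?S \<noteq> {}" using solution_family by blast
    show "convergent (\<lambda>k. \<Sum>i<n. c i * (norm (u (Suc k) i - s i))\<^sup>2)" if "s \<in> ?S" for s
      using distance_convergent(1)[of s] that
        convergent_Suc_iff[of "\<lambda>k. \<Sum>i<n. c i * (norm (u k i - s i))\<^sup>2"] by simp
    show "l \<in> ?S" if "strict_mono r"
      "\<And>i. i \<in> {..<n} \<Longrightarrow> weakly_converges_on (H i) (\<lambda>k. u (Suc (r k)) i) (l i)" for r l
      using weak_cluster_point_solution[OF that(1), of l] that(2) by simp
  qed (simp_all add: c_pos H_hilbert u_mem)
  then obtain l where l: "(l 0, l) \<in> extended_solution_set n H T G"
    "\<And>i. i < n \<Longrightarrow> weakly_converges_on (H i) (\<lambda>k. u (Suc k) i) (l i)" by auto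
  have mono: "strict_mono (\<lambda>k::nat. k)" by (simp add: strict_mono_def)
  have "weakly_converges_on (H i) (\<lambda>k. x k i) (G i (l 0)) \<and>
      weakly_converges_on (H i) (\<lambda>k. y k i) (with_last n H G l i)" if i: "1 \<le> i" "i \<le> n" for i
    by (intro conjI weak_limits_along_subseq(1)[OF mono l(2) i] weak_limits_along_subseq(2)[OF mono l(2) i])
  then show ?thesis using l by auto
qed

end

end

theorem theorem3p5:
  fixes n :: nat
    and H :: "nat \<Rightarrow> 'a::real_inner set"
    and T :: "nat \<Rightarrow> 'a \<Rightarrow> 'a set"
    and G :: "nat \<Rightarrow> 'a \<Rightarrow> 'a"
    and \<gamma> \<alpha>' \<sigma> \<beta>_lo \<beta>_hi \<rho>_lo \<rho>_hi :: real
    and z :: "int \<Rightarrow> 'a"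
    and w :: "int \<Rightarrow> nat \<Rightarrow> 'a"
    and p :: "int \<Rightarrow> 'a \<times> (nat \<Rightarrow> 'a)"
    and x y e :: "nat \<Rightarrow> nat \<Rightarrow> 'a"
    and \<alpha> \<beta> :: "nat \<Rightarrow> real"
    and \<rho> :: "nat \<Rightarrow> nat \<Rightarrow> real"
  assumes "splitting_problem n H T G"
    and "inertial_splitting_run n H T G \<gamma> \<alpha>' \<sigma> \<beta>_lo \<beta>_hi z w x y e \<alpha> \<rho> \<beta>"
    and "\<And>k. k \<ge> - 1 \<Longrightarrow> p k = (z k, w k)"
    and "summable (\<lambda>k. \<alpha> k * (norm_gamma n \<gamma> (p (int k) - p (int k - 1)))\<^sup>2)"
    and "0 < \<rho>_lo"
    and "\<And>k i. i \<in> {1..n} \<Longrightarrow> \<rho>_lo \<le> \<rho> k i \<and> \<rho> k i \<le> \<rho>_hi"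
  shows "\<exists>z_inf w_inf.
           (z_inf, w_inf) \<in> extended_solution_set n H T G \<and>
           weakly_converges_on (H 0) (\<lambda>k. z (int k)) z_inf \<and>
           (\<forall>i\<in>{1..<n}. weakly_converges_on (H i) (\<lambda>k. w (int k) i) (w_inf i)) \<and>
           (\<forall>i\<in>{1..n}. weakly_converges_on (H i) (\<lambda>k. x k i) (G i z_inf) \<and>
                       weakly_converges_on (H i) (\<lambda>k. y k i) (with_last n H G w_inf i))"
proof -
  interpret inertial_splitting n H T G \<gamma> \<alpha>' \<sigma> \<beta>_lo \<beta>_hi \<rho>_lo \<rho>_hi z w x y e \<alpha> \<beta> \<rho>
    by unfold_locales (rule assms(1,2,5) | erule assms(6))+
  have "(norm_gamma n \<gamma> (p (int k) - p (int k - 1)))\<^sup>2 =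
      (\<Sum>i<n. c i * (norm (u (Suc k) i - u k i))\<^sup>2)" for k
  proof -
    \<comment> \<open>Nonnegativity lets the square undo the root in \<open>norm_gamma\<close>; at
      \<open>k = 0\<close> the difference involves iterate \<open>-1\<close>, stored as
      \<open>u 0\<close>.\<close>
    have "0 \<le> inner_gamma n \<gamma> q q" for q :: "'a \<times> (nat \<Rightarrow> 'a)"
      using parameters(7) by (auto simp: inner_gamma_def intro!: add_nonneg_nonneg sum_nonneg)
    then have "(norm_gamma n \<gamma> (p (int k) - p (int k - 1)))\<^sup>2 =
        inner_gamma n \<gamma> (p (int k) - p (int k - 1)) (p (int k) - p (int k - 1))"
      by (simp add: norm_gamma_def)
    also have "\<dots> = (\<Sum>i<n. c i * (norm (u (Suc k) i - u k i))\<^sup>2)"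
      using n_ge assms(3)[of "int k"] assms(3)[of "int k - 1"]
      by (subst sum_lessThan_split_0)
        (auto simp: inner_gamma_def c_def u_def power2_norm_eq_inner intro!: sum.cong)
    finally show ?thesis .
  qed
  then have "summable (\<lambda>k. \<alpha> k * (\<Sum>i<n. c i * (norm (u (Suc k) i - u k i))\<^sup>2))"
    using assms(4) by simp
  then obtain l where l: "(l 0, l) \<in> extended_solution_set n H T G"
    "\<forall>i<n. weakly_converges_on (H i) (\<lambda>k. u (Suc k) i) (l i)"
    "\<forall>i\<in>{1..n}. weakly_converges_on (H i) (\<lambda>k. x k i) (G i (l 0)) \<and>
      weakly_converges_on (H i) (\<lambda>k. y k i) (with_last n H G l i)"
    using weak_convergence by blast
  have "weakly_converges_on (H 0) (\<lambda>k. z (int k)) (l 0)"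
    using l(2)[rule_format, of 0] n_ge by (simp add: u_def)
  moreover have "weakly_converges_on (H i) (\<lambda>k. w (int k) i) (l i)" if "i \<in> {1..<n}" for i
    using l(2)[rule_format, of i] that by (simp add: u_def)
  ultimately show ?thesis
    using l(1,3) by blast
qed

end
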